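(* Put $c=1-Z$, $b_1=\frac12+\alpha$, $b_2=\frac12+\beta$. On the curve $y=\dfrac{x}{2x-1}$ (equivalently $x+y=2xy$) one has, for generic parameters and then by meromorphic continuation, $$\mathcal F\!\left(\alpha,\beta;Z;x,\frac{x}{2x-1}\right)=(1-x)^{c-1}(1-2x)^{b_2}\;{}_2F_1\!\left(\frac{b_2-b_1+c}{2},\frac{b_1+b_2+c-1}{2};c;4x(1-x)\right).$$ The branches are those obtained by analytic continuation from a neighbourhood of $x=0$ (where the powers take the value $1$ at $x=0$) along the chosen path.
   Context: $\mathcal F$ is the Appell $F_3$ function $$\mathcal F(\alpha,\beta;Z;x,y)=\sum_{\mu,\nu\ge0}\frac{(\frac12-\alpha)_\mu(\frac12+\alpha)_\mu(\frac12-\beta)_\nu(\frac12+\beta)_\nu}{(1-Z)_{\mu+\nu}\,\mu!\,\nu!}\,x^\mu y^\nu ,$$ where $(z)_k$ is the Pochhammer symbol, and its analytic continuation. In particular the displayed identity is an identity of analytic germs at $x=0$, both sides then being continued analytically along any path from near $x=0$ avoiding the singular locus. *)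

theory Defs
  imports "HOL-Analysis.Analysis"
begin

definition appell_F3_term ::
    "complex \<Rightarrow> complex \<Rightarrow> complex \<Rightarrow> complex \<Rightarrow> complex \<Rightarrow> nat \<times> nat \<Rightarrow> complex" where
  "appell_F3_term \<alpha> \<beta> Z x y = (\<lambda>(\<mu>, \<nu>).
     (pochhammer (1/2 - \<alpha>) \<mu> * pochhammer (1/2 + \<alpha>) \<mu> *
      pochhammer (1/2 - \<beta>) \<nu> * pochhammer (1/2 + \<beta>) \<nu>) /
     (pochhammer (1 - Z) (\<mu> + \<nu>) * fact \<mu> * fact \<nu>) * x ^ \<mu> * y ^ \<nu>)"

definition appell_F3 :: "complex \<Rightarrow> complex \<Rightarrow> complex \<Rightarrow> complex \<Rightarrow> complex \<Rightarrow> complex" where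
  "appell_F3 \<alpha> \<beta> Z x y = infsum (appell_F3_term \<alpha> \<beta> Z x y) UNIV"

text \<open>The Gauss series; meaningful only inside the unit disc.\<close>

definition hyp2F1 :: "complex \<Rightarrow> complex \<Rightarrow> complex \<Rightarrow> complex \<Rightarrow> complex" where
  "hyp2F1 a b c z = eval_fps (fps_hypergeo [a, b] [c] 1) z"

definition analytic1_at :: "(complex \<Rightarrow> complex) \<Rightarrow> complex \<Rightarrow> bool" where
  "analytic1_at f z \<longleftrightarrow> f analytic_on {z}"

text \<open>Analyticity of a function of two complex variables: the Frechet derivative exists and is
  complex-linear throughout a neighbourhood of the point.\<close>

definition analytic2_at :: "(complex \<times> complex \<Rightarrow> complex) \<Rightarrow> complex \<times> complex \<Rightarrow> bool" where
  "analytic2_at f p \<longleftrightarrow>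
     (\<exists>U. open U \<and> p \<in> U \<and>
        (\<forall>q\<in>U. \<exists>a b. (f has_derivative (\<lambda>(h, k). a * h + b * k)) (at q)))"

text \<open>\<open>\<Phi>\<close> is an analytic continuation along the path \<open>\<gamma>\<close> of the germ of \<open>f\<close> at \<open>\<gamma> 0\<close>:
  each \<open>\<Phi> t\<close> represents a germ at \<open>\<gamma> t\<close> that is analytic in the sense of \<open>A\<close>, and for \<open>s\<close> close to
  \<open>t\<close> the germ of \<open>\<Phi> s\<close> at \<open>\<gamma> s\<close> is that of \<open>\<Phi> t\<close>.  Only the germ of \<open>\<Phi> t\<close> at \<open>\<gamma> t\<close> matters.\<close>

definition continuation_along ::
    "(('a::topological_space \<Rightarrow> complex) \<Rightarrow> 'a \<Rightarrow> bool) \<Rightarrow> (real \<Rightarrow> 'a) \<Rightarrow>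
     ('a \<Rightarrow> complex) \<Rightarrow> (real \<Rightarrow> 'a \<Rightarrow> complex) \<Rightarrow> bool" where
  "continuation_along A \<gamma> f \<Phi> \<longleftrightarrow>
     path \<gamma> \<and>
     (\<forall>t\<in>{0..1}. A (\<Phi> t) (\<gamma> t)) \<and>
     (\<forall>t\<in>{0..1}. \<forall>\<^sub>F s in at t within {0..1}. \<forall>\<^sub>F z in nhds (\<gamma> s). \<Phi> s z = \<Phi> t z) \<and>
     (\<forall>\<^sub>F z in nhds (\<gamma> 0). \<Phi> 0 z = f z)"

end

theory Submission
  imports Defs "HOL-Complex_Analysis.Complex_Analysis"
begin

text \<open>
  The identity near \<open>x = 0\<close>. Write \<open>b1 = 1/2 + \<alpha>\<close>, \<open>b2 = 1/2 + \<beta>\<close>, \<open>N = c - b1\<close>. Summing the Appell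
  series over \<open>\<mu>\<close> first leaves a series in \<open>y ^ \<nu>\<close> with coefficients proportional to the Gauss functions
  \<open>F(b1, 1 - b1; c + \<nu>; x)\<close>. The two upper parameters add up to 1, so each of them has a quadratic
  transformation (\<open>quadratic_transformation\<close>) to the argument \<open>z = -4 x (1 - x) / (1 - 2 x)^2\<close>, with a
  prefactor whose \<open>\<nu>\<close>-dependence is \<open>((1 - x) / (1 - 2 x)) ^ \<nu>\<close>. This is where the curve matters: for
  \<open>y = x / (2 x - 1)\<close> one has \<open>y (1 - x) / (1 - 2 x) = z / 4\<close>, and everything becomes a double power series in
  the single variable \<open>z\<close>. Collecting the powers of \<open>z\<close> produces in each degree a terminating \<open>3F2\<close> at 1 of
  Whipple's type (\<open>whipple_sum\<close>), and the resulting closed forms are the coefficients of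
  \<open>F((N + b2)/2, (N + 1 - b2)/2; c; z)\<close>. Pfaff's transformation (\<open>pfaff_transformation\<close>) turns this into the
  stated function of \<open>4 x (1 - x)\<close>.

  Both transformations come from one principle: when \<open>c\<close> is not a nonpositive integer, a solution of
  Gauss's differential equation that is holomorphic at 0 is determined by its value there
  (\<open>gauss_solution_at_0_unique\<close>), and a product \<open>u(x) F(z(x))\<close> solves such an equation as soon as three
  rational identities hold (\<open>gauss_solution_pullback\<close>).

  The continuation along paths. Continuations of a germ along a path are unique
  (\<open>continuation_unique\<close>), so the identity propagates from the initial germ once all factors are
  known to continue. For the Gauss function this is the local solvability of its differential equation
  away from 0 and 1 with a radius that is locally uniform (\<open>gauss_solution_local_extension\<close>), fed into
  a connectedness argument on the parameter interval (\<open>continuation_exists\<close>). The powers are covered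
  by the same result, because \<open>(1 - x) powr p\<close> is itself the Gauss function \<open>F(-p, 1; 1; x)\<close>. A continuation of the
  Appell function in two variables restricts to the curve by composition.
\<close>

section \<open>Power series solutions of Gauss's differential equation\<close>

definition gauss_solution :: "complex \<Rightarrow> complex \<Rightarrow> complex \<Rightarrow> (complex \<Rightarrow> complex) \<Rightarrow> complex set \<Rightarrow> bool" where
  "gauss_solution a b c f S \<longleftrightarrow> f holomorphic_on S \<and>
     (\<forall>z\<in>S. z * (1 - z) * deriv (deriv f) z + (c - (a + b + 1) * z) * deriv f z - a * b * f z = 0)"

text \<open>
  The recurrence that Gauss's equation imposes on the Taylor coefficients at the base point \<open>q\<close>. At \<open>q = 0\<close>
  the leading term drops out and the two-term recurrence of the hypergeometric series remains.
\<close>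

definition gauss_recurrence :: "complex \<Rightarrow> complex \<Rightarrow> complex \<Rightarrow> complex \<Rightarrow> complex fps \<Rightarrow> bool" where
  "gauss_recurrence a b c q F \<longleftrightarrow> (\<forall>n.
     q * (1 - q) * (of_nat n + 2) * (of_nat n + 1) * fps_nth F (n + 2) +
     (of_nat n + 1) * ((1 - 2 * q) * of_nat n + c - (a + b + 1) * q) * fps_nth F (n + 1) =
     (of_nat n + a) * (of_nat n + b) * fps_nth F n)"

lemma gauss_solutionI:
  assumes "open S"
    and "\<And>z. z \<in> S \<Longrightarrow> (f has_field_derivative g z) (at z)"
    and "\<And>z. z \<in> S \<Longrightarrow> (g has_field_derivative h z) (at z)"
    and "\<And>z. z \<in> S \<Longrightarrow> z * (1 - z) * h z + (c - (a + b + 1) * z) * g z - a * b * f z = 0"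
  shows "gauss_solution a b c f S"
  unfolding gauss_solution_def
proof (intro conjI ballI)
  show "f holomorphic_on S"
    using assms(1,2) holomorphic_on_open by blast
next
  fix z assume z: "z \<in> S"
  have 1: "deriv f w = g w" if "w \<in> S" for w
    using assms(2)[OF that] by (rule DERIV_imp_deriv)
  have "\<forall>\<^sub>F w in nhds z. deriv f w = g w"
    using eventually_nhds_in_open[OF assms(1) z] by eventually_elim (rule 1)
  then have "deriv (deriv f) z = deriv g z"
    by (rule deriv_cong_ev) simp
  also have "\<dots> = h z"
    using assms(3)[OF z] by (rule DERIV_imp_deriv)
  finally show "z * (1 - z) * deriv (deriv f) z + (c - (a + b + 1) * z) * deriv f z - a * b * f z = 0"
    using assms(4)[OF z] 1[OF z] by simp
qed

text \<open>
  Substituting \<open>q + X\<close> for the variable turns Gauss's operator into an operator on formal power series;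
  its coefficients give the recurrence in both directions, for necessity and for sufficiency.
\<close>

lemma gauss_operator_nth:
  "fps_nth ((fps_const q + fps_X) * (1 - (fps_const q + fps_X)) * fps_deriv (fps_deriv F)
      + (fps_const c - fps_const (a + b + 1) * (fps_const q + fps_X)) * fps_deriv F
      - fps_const (a * b) * F) n =
    q * (1 - q) * (of_nat n + 2) * (of_nat n + 1) * fps_nth F (n + 2) +
     (of_nat n + 1) * ((1 - 2 * q) * of_nat n + c - (a + b + 1) * q) * fps_nth F (n + 1) -
     (of_nat n + a) * (of_nat n + b) * fps_nth F (n :: nat)"
  for q a b c :: complex
proof -
  define G where "G = fps_deriv F"
  define H where "H = fps_deriv G"
  have e: "(fps_const q + fps_X) * (1 - (fps_const q + fps_X)) * H
      + (fps_const c - fps_const (a + b + 1) * (fps_const q + fps_X)) * G - fps_const (a * b) * F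
    = fps_const (q * (1 - q)) * H + fps_const (1 - 2 * q) * (fps_X * H) - fps_X * (fps_X * H)
      + fps_const (c - (a + b + 1) * q) * G - fps_const (a + b + 1) * (fps_X * G)
      - fps_const (a * b) * F"
    by (simp add: fps_const_mult[symmetric] fps_const_add[symmetric] fps_const_sub[symmetric]
        algebra_simps del: fps_const_mult fps_const_add fps_const_sub flip: fps_numeral_fps_const)
  have cases: "n = 0 \<or> n = 1 \<or> (\<exists>m. n = Suc (Suc m))"
    by (metis One_nat_def not0_implies_Suc)
  show ?thesis
    unfolding G_def[symmetric] H_def[symmetric] e
    using cases by (auto simp: H_def G_def fps_X_mult_nth algebra_simps numeral_2_eq_2)
qed

lemma gauss_solution_imp_recurrence:
  assumes "gauss_solution a b c f S" "open S" "q \<in> S"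
  shows "gauss_recurrence a b c q (fps_expansion f q)"
proof -
  define F where "F = fps_expansion f q"
  have f: "f holomorphic_on S"
    and ode: "\<And>z. z \<in> S \<Longrightarrow> z * (1 - z) * deriv (deriv f) z + (c - (a + b + 1) * z) * deriv f z - a * b * f z = 0"
    using assms(1) unfolding gauss_solution_def by auto
  have f1: "deriv f holomorphic_on S" and f2: "deriv (deriv f) holomorphic_on S"
    using f assms(2) by (auto intro!: holomorphic_deriv)
  have F1: "fps_expansion (deriv g) q = fps_deriv (fps_expansion g q)" for g
    by (rule fps_ext) (simp add: fps_expansion_def funpow_swap1 del: of_nat_Suc)
  have an: "g analytic_on {q}" if "g holomorphic_on S" for g
    using that assms(2,3) analytic_at by blast
  have [fps_expansion_intros]: "(\<lambda>x. f (q + x)) has_fps_expansion F"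
    unfolding F_def by (rule analytic_at_imp_has_fps_expansion[OF an[OF f]])
  have [fps_expansion_intros]: "(\<lambda>x. deriv f (q + x)) has_fps_expansion fps_deriv F"
    unfolding F_def F1[symmetric] by (rule analytic_at_imp_has_fps_expansion[OF an[OF f1]])
  have [fps_expansion_intros]: "(\<lambda>x. deriv (deriv f) (q + x)) has_fps_expansion fps_deriv (fps_deriv F)"
    unfolding F_def F1[symmetric] by (rule analytic_at_imp_has_fps_expansion[OF an[OF f2]])
  let ?L = "(fps_const q + fps_X) * (1 - (fps_const q + fps_X)) * fps_deriv (fps_deriv F)
      + (fps_const c - fps_const (a + b + 1) * (fps_const q + fps_X)) * fps_deriv F
      - fps_const (a * b) * F"
  have L: "(\<lambda>x. (q + x) * (1 - (q + x)) * deriv (deriv f) (q + x)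
      + (c - (a + b + 1) * (q + x)) * deriv f (q + x) - a * b * f (q + x)) has_fps_expansion ?L"
    by (intro fps_expansion_intros)
  have "\<forall>\<^sub>F x in nhds 0. q + x \<in> S"
    using assms(2,3) by (intro eventually_compose_filterlim[OF eventually_nhds_in_open])
      (auto intro!: tendsto_eq_intros filterlim_ident)
  then have "\<forall>\<^sub>F x in nhds 0. (q + x) * (1 - (q + x)) * deriv (deriv f) (q + x)
      + (c - (a + b + 1) * (q + x)) * deriv f (q + x) - a * b * f (q + x) = 0"
    by eventually_elim (rule ode)
  then have "(\<lambda>x. (q + x) * (1 - (q + x)) * deriv (deriv f) (q + x)
      + (c - (a + b + 1) * (q + x)) * deriv f (q + x) - a * b * f (q + x)) has_fps_expansion 0"
    by (simp add: has_fps_expansion_0_iff)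
  with L have "?L = 0"
    using fps_expansion_unique_complex by blast
  then have "fps_nth ?L n = 0" for n by simp
  then show ?thesis
    unfolding gauss_recurrence_def F_def[symmetric] gauss_operator_nth by simp
qed

lemma gauss_solution_eval_fps:
  assumes rec: "gauss_recurrence a b c q F" and R: "ereal R \<le> fps_conv_radius F"
  shows "gauss_solution a b c (\<lambda>z. eval_fps F (z - q)) (ball q R)"
proof (rule gauss_solutionI[where g = "\<lambda>z. eval_fps (fps_deriv F) (z - q)"
      and h = "\<lambda>z. eval_fps (fps_deriv (fps_deriv F)) (z - q)"])
  have R1: "ereal R \<le> fps_conv_radius (fps_deriv F)"
    using R fps_conv_radius_deriv[of F] by (rule order_trans)
  have R2: "ereal R \<le> fps_conv_radius (fps_deriv (fps_deriv F))"
    using R1 fps_conv_radius_deriv[of "fps_deriv F"] by (rule order_trans)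
  have in_ball: "ereal (norm (z - q)) < ereal R" if "z \<in> ball q R" for z
    using that by (simp add: dist_norm norm_minus_commute)
  {
    fix G :: "complex fps" and z assume "ereal R \<le> fps_conv_radius G" "z \<in> ball q R"
    then have "(eval_fps G has_field_derivative eval_fps (fps_deriv G) (z - q)) (at (z - q))"
      by (intro has_field_derivative_eval_fps) (metis in_ball order.strict_trans2)
    then have "((\<lambda>z. eval_fps G (z - q)) has_field_derivative eval_fps (fps_deriv G) (z - q) * 1) (at z)"
      by (rule DERIV_chain2) (auto intro!: derivative_eq_intros)
    then have "((\<lambda>z. eval_fps G (z - q)) has_field_derivative eval_fps (fps_deriv G) (z - q)) (at z)"
      by simp
  } note D = this
  show "((\<lambda>z. eval_fps F (z - q)) has_field_derivative eval_fps (fps_deriv F) (z - q)) (at z)"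
    if "z \<in> ball q R" for z using D[OF R that] .
  show "((\<lambda>z. eval_fps (fps_deriv F) (z - q)) has_field_derivative
          eval_fps (fps_deriv (fps_deriv F)) (z - q)) (at z)"
    if "z \<in> ball q R" for z using D[OF R1 that] .
  fix z assume z: "z \<in> ball q R"
  note zz = in_ball[OF z]
  define x where "x = z - q"
  have r: "ereal (norm x) < fps_conv_radius F" "ereal (norm x) < fps_conv_radius (fps_deriv F)"
      "ereal (norm x) < fps_conv_radius (fps_deriv (fps_deriv F))"
    using zz R R1 R2 unfolding x_def by (metis order.strict_trans2)+
  let ?A = "(fps_const q + fps_X) * (1 - (fps_const q + fps_X))"
  let ?B = "fps_const c - fps_const (a + b + 1) * (fps_const q + fps_X)"
  have inf: "fps_conv_radius (f + g) = \<infinity>" "fps_conv_radius (f - g) = \<infinity>" "fps_conv_radius (f * g) = \<infinity>"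
    if "fps_conv_radius f = \<infinity>" "fps_conv_radius g = \<infinity>" for f g :: "complex fps"
    using fps_conv_radius_add[of f g] fps_conv_radius_diff[of f g] fps_conv_radius_mult[of f g] that
    by auto
  have A: "fps_conv_radius ?A = \<infinity>" "fps_conv_radius ?B = \<infinity>"
    by (intro inf; simp)+
  have B: "eval_fps ?A x = z * (1 - z)" "eval_fps ?B x = c - (a + b + 1) * z"
    by (simp_all add: eval_fps_mult eval_fps_add eval_fps_diff inf x_def)
  have m: "ereal (norm x) < fps_conv_radius (f * g)" "ereal (norm x) < fps_conv_radius (f + g)"
    if "ereal (norm x) < fps_conv_radius f" "ereal (norm x) < fps_conv_radius g" for f g :: "complex fps"
    using order.strict_trans2[OF _ fps_conv_radius_mult[of f g]]
      order.strict_trans2[OF _ fps_conv_radius_add[of f g]] that by simp_all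
  have "?A * fps_deriv (fps_deriv F) + ?B * fps_deriv F - fps_const (a * b) * F = 0"
    using rec unfolding gauss_recurrence_def by (intro fps_ext) (simp only: gauss_operator_nth, simp)
  then have "eval_fps (?A * fps_deriv (fps_deriv F) + ?B * fps_deriv F - fps_const (a * b) * F) x = 0"
    by simp
  moreover have "eval_fps (?A * fps_deriv (fps_deriv F) + ?B * fps_deriv F - fps_const (a * b) * F) x =
     z * (1 - z) * eval_fps (fps_deriv (fps_deriv F)) x + (c - (a + b + 1) * z) * eval_fps (fps_deriv F) x
     - a * b * eval_fps F x"
    using r by (simp add: eval_fps_mult eval_fps_diff eval_fps_add m A B)
  ultimately show "z * (1 - z) * eval_fps (fps_deriv (fps_deriv F)) (z - q)
      + (c - (a + b + 1) * z) * eval_fps (fps_deriv F) (z - q) - a * b * eval_fps F (z - q) = 0"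
    by (simp add: x_def)
qed auto

abbreviation gauss_series :: "complex \<Rightarrow> complex \<Rightarrow> complex \<Rightarrow> complex fps" where
  "gauss_series a b c \<equiv> fps_hypergeo [a, b] [c] 1"

lemma gauss_series_nth:
  "fps_nth (gauss_series a b c) n = pochhammer a n * pochhammer b n / (pochhammer c n * fact n)"
  by simp

declare fps_hypergeo_nth [simp del]

lemma shifted_nonzero: "c + of_nat n \<noteq> 0" if "c \<notin> \<int>\<^sub>\<le>\<^sub>0" for c :: complex
proof
  assume "c + of_nat n = 0"
  then have "c = - of_nat n" by (simp add: eq_neg_iff_add_eq_0)
  then show False using that by simp
qed

lemma gauss_series_Suc:
  assumes "c \<notin> \<int>\<^sub>\<le>\<^sub>0"
  shows "(of_nat n + 1) * (of_nat n + c) * fps_nth (gauss_series a b c) (Suc n) =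
      (of_nat n + a) * (of_nat n + b) * fps_nth (gauss_series a b c) n"
proof -
  have "of_nat n + 1 \<noteq> (0 :: complex)" "of_nat n + c \<noteq> 0" "pochhammer c n \<noteq> 0"
    using shifted_nonzero[OF assms, of n] of_nat_neq_0[of n, where ?'a = complex] assms
    by (auto simp: add_ac pochhammer_eq_0_iff)
  then show ?thesis
    by (simp add: gauss_series_nth pochhammer_Suc divide_simps add_ac mult_ac)
qed

lemma gauss_recurrence_gauss_series:
  assumes "c \<notin> \<int>\<^sub>\<le>\<^sub>0"
  shows "gauss_recurrence a b c 0 (gauss_series a b c)"
  unfolding gauss_recurrence_def using gauss_series_Suc[OF assms] by simp

text \<open>
  The ratio of consecutive terms tends to 1. The ratio test is used in the form of an inequality, which also
  covers the terminating series, where the quotient of coefficients is undefined.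
\<close>

lemma gauss_series_conv_radius:
  assumes "c \<notin> \<int>\<^sub>\<le>\<^sub>0"
  shows "1 \<le> fps_conv_radius (gauss_series a b c)"
  unfolding fps_conv_radius_def
proof (rule conv_radius_geI_ex)
  fix r :: real assume r: "0 < r" "ereal r < 1"
  let ?u = "\<lambda>n. fps_nth (gauss_series a b c) n"
  define q where "q n = (of_nat n + a) * (of_nat n + b) / ((of_nat n + 1) * (of_nat n + c))" for n
  have q: "?u (Suc n) = q n * ?u n" for n
  proof -
    have "of_nat n + 1 \<noteq> (0 :: complex)" "of_nat n + c \<noteq> 0"
      using shifted_nonzero[OF assms, of n] of_nat_neq_0[of n, where ?'a = complex] by (auto simp: add_ac)
    then show ?thesis
      using gauss_series_Suc[OF assms, of n a b] by (simp add: q_def divide_simps mult_ac)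
  qed
  have lim: "(\<lambda>n. (of_nat n + d) / of_nat n) \<longlonglongrightarrow> (1 :: complex)" for d
  proof -
    have "(\<lambda>n. 1 + d * (1 / of_nat n)) \<longlonglongrightarrow> 1 + d * 0"
      by (intro tendsto_intros lim_1_over_n)
    moreover have "\<forall>\<^sub>F n in sequentially. 1 + d * (1 / of_nat n) = (of_nat n + d) / of_nat n"
      using eventually_gt_at_top[of 0] by eventually_elim (simp add: divide_simps)
    ultimately have "(\<lambda>n. (of_nat n + d) / of_nat n) \<longlonglongrightarrow> 1 + d * 0"
      by (rule Lim_transform_eventually)
    then show ?thesis by simp
  qed
  have "(\<lambda>n. ((of_nat n + a) / of_nat n * ((of_nat n + b) / of_nat n)) /
      ((of_nat n + 1) / of_nat n * ((of_nat n + c) / of_nat n))) \<longlonglongrightarrow> 1 * 1 / (1 * 1)"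
    by (intro tendsto_intros lim) auto
  moreover have "\<forall>\<^sub>F n in sequentially. ((of_nat n + a) / of_nat n * ((of_nat n + b) / of_nat n)) /
      ((of_nat n + 1) / of_nat n * ((of_nat n + c) / of_nat n)) = q n"
    using eventually_gt_at_top[of 0] by eventually_elim (simp add: q_def)
  ultimately have "q \<longlonglongrightarrow> 1 * 1 / (1 * 1)"
    by (rule Lim_transform_eventually)
  then have "q \<longlonglongrightarrow> 1" by simp
  then have "(\<lambda>n. norm (q n) * r) \<longlonglongrightarrow> norm (1 :: complex) * r"
    by (intro tendsto_intros)
  moreover have "norm (1 :: complex) * r < (1 + r) / 2"
    using r by simp
  ultimately have "\<forall>\<^sub>F n in sequentially. norm (q n) * r < (1 + r) / 2"
    by (rule order_tendstoD)
  then obtain N where N: "\<And>n. n \<ge> N \<Longrightarrow> norm (q n) * r < (1 + r) / 2"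
    unfolding eventually_sequentially by blast
  have "summable (\<lambda>n. ?u n * of_real r ^ n)"
  proof (rule summable_ratio_test)
    show "(1 + r) / 2 < 1" using r by simp
    fix n assume "n \<ge> N"
    have "norm (?u (Suc n) * of_real r ^ Suc n) = (norm (q n) * r) * norm (?u n * of_real r ^ n)"
      using r unfolding q by (simp add: norm_mult norm_power)
    also have "\<dots> \<le> (1 + r) / 2 * norm (?u n * of_real r ^ n)"
      using N[OF \<open>n \<ge> N\<close>] by (intro mult_right_mono) auto
    finally show "norm (?u (Suc n) * of_real r ^ Suc n) \<le> (1 + r) / 2 * norm (?u n * of_real r ^ n)" .
  qed
  then show "\<exists>z. norm z = r \<and> summable (\<lambda>n. ?u n * z ^ n)"
    using r by (intro exI[of _ "of_real r"]) simp
qed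

lemma gauss_solution_hyp2F1:
  assumes "c \<notin> \<int>\<^sub>\<le>\<^sub>0"
  shows "gauss_solution a b c (hyp2F1 a b c) (ball 0 1)"
  using gauss_solution_eval_fps[OF gauss_recurrence_gauss_series[OF assms], of 1 a b]
    gauss_series_conv_radius[OF assms, of a b]
  by (simp add: hyp2F1_def[abs_def] one_ereal_def)

text \<open>
  At the singular point 0 the indicial exponents are 0 and \<open>1 - c\<close>. If \<open>c\<close> is not a nonpositive integer, the
  recurrence can be solved for the next coefficient at every step, so the value at 0 fixes the solution.
\<close>

lemma gauss_solution_at_0_unique:
  assumes f: "gauss_solution a b c f (ball 0 R)" and "z \<in> ball 0 R" "R \<le> 1" and c: "c \<notin> \<int>\<^sub>\<le>\<^sub>0"
  shows "f z = f 0 * hyp2F1 a b c z"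
proof -
  define F where "F = fps_expansion f 0"
  have R: "R > 0" using assms(2) by (auto simp: dist_norm intro: le_less_trans[OF norm_ge_zero])
  have norm1: "ereal (norm z) < fps_conv_radius (gauss_series a b c)"
    using assms(2,3) by (intro less_le_trans[OF _ gauss_series_conv_radius[OF c]]) simp
  have hol: "f holomorphic_on ball 0 R" using f by (simp add: gauss_solution_def)
  have "gauss_recurrence a b c 0 F"
    unfolding F_def by (rule gauss_solution_imp_recurrence[OF f]) (use R in auto)
  then have F: "(of_nat n + 1) * (of_nat n + c) * fps_nth F (Suc n) = (of_nat n + a) * (of_nat n + b) * fps_nth F n" for n
    by (simp add: gauss_recurrence_def)
  have nth: "fps_nth F n = f 0 * fps_nth (gauss_series a b c) n" for n
  proof (induction n)
    case 0
    show ?case by (simp add: F_def fps_expansion_def)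
  next
    case (Suc n)
    have nz: "of_nat n + 1 \<noteq> (0 :: complex)" "of_nat n + c \<noteq> 0"
      using shifted_nonzero[OF c, of n] of_nat_neq_0[of n, where ?'a = complex] by (auto simp: add_ac)
    have "(of_nat n + 1) * (of_nat n + c) * fps_nth F (Suc n)
      = (of_nat n + 1) * (of_nat n + c) * (f 0 * fps_nth (gauss_series a b c) (Suc n))"
      using F[of n] gauss_series_Suc[OF c, of n a b] Suc by (simp add: mult_ac)
    then show ?case using nz by simp
  qed
  have "f analytic_on {0}"
    using hol R analytic_at by (meson centre_in_ball open_ball)
  then have "f has_fps_expansion F"
    unfolding F_def by (rule analytic_at_imp_has_fps_expansion_0)
  then have "f z = eval_fps F z"
    using has_fps_expansion_imp_eval_fps_eq[OF _ _ hol] assms(2) by (simp add: dist_norm)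
  also have "F = fps_const (f 0) * gauss_series a b c"
    by (rule fps_ext) (simp add: nth)
  also have "eval_fps \<dots> z = f 0 * hyp2F1 a b c z"
    using gauss_series_conv_radius[OF c, of a b] norm1
    by (simp add: eval_fps_mult hyp2F1_def)
  finally show ?thesis .
qed

text \<open>
  At a regular point the recurrence has order two, so two vanishing coefficients force all others to vanish.
\<close>

lemma gauss_solution_zero:
  assumes f: "gauss_solution a b c f S" "open S" "q \<in> S" and q: "q \<noteq> 0" "q \<noteq> 1"
    and "f q = 0" "deriv f q = 0"
  shows "\<forall>\<^sub>F z in nhds q. f z = 0"
proof -
  define F where "F = fps_expansion f q"
  have rec: "gauss_recurrence a b c q F"
    unfolding F_def by (rule gauss_solution_imp_recurrence[OF f])
  have nth: "fps_nth F n = 0 \<and> fps_nth F (Suc n) = 0" for n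
  proof (induction n)
    case 0
    show ?case using assms by (simp add: F_def fps_expansion_def)
  next
    case (Suc n)
    have "q * (1 - q) * (of_nat n + 2) * (of_nat n + 1) * fps_nth F (n + 2) = 0"
      using rec Suc unfolding gauss_recurrence_def by (metis Suc_eq_plus1 add.right_neutral mult_zero_right)
    moreover have "of_nat n + 2 \<noteq> (0 :: complex)" "of_nat n + 1 \<noteq> (0 :: complex)"
      using of_nat_neq_0[of n, where ?'a = complex] of_nat_neq_0[of "Suc n", where ?'a = complex] by (auto simp: add_ac)
    ultimately have "fps_nth F (n + 2) = 0" using q by simp
    then show ?case using Suc by simp
  qed
  have "F = 0" by (rule fps_ext) (simp add: nth)
  moreover have "(\<lambda>x. f (q + x)) has_fps_expansion F"
    unfolding F_def using f analytic_at
    by (intro analytic_at_imp_has_fps_expansion) (auto simp: gauss_solution_def)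
  ultimately have "\<forall>\<^sub>F x in nhds 0. f (q + x) = 0"
    by (simp add: has_fps_expansion_0_iff)
  then have "\<forall>\<^sub>F x in nhds q. f (q + (x - q)) = 0"
    by (rule eventually_compose_filterlim) (auto intro!: tendsto_eq_intros filterlim_ident)
  then show ?thesis by simp
qed

text \<open>
  A bound for the growth of the Taylor coefficients at \<open>q\<close>: when the recurrence is solved for the coefficient of index
  \<open>n + 2\<close>, the multipliers of the two preceding coefficients have norms whose sum is at most this number. It is continuous in \<open>q\<close>
  away from 0 and 1, which makes the radius of convergence locally uniform.
\<close>

definition gauss_bound :: "complex \<Rightarrow> complex \<Rightarrow> complex \<Rightarrow> complex \<Rightarrow> real" where
  "gauss_bound a b c q =
     (norm (1 - 2 * q) + norm (c - (a + b + 1) * q) + (1 + norm a) * (1 + norm b)) / norm (q * (1 - q))"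

fun gauss_coeffs :: "complex \<Rightarrow> complex \<Rightarrow> complex \<Rightarrow> complex \<Rightarrow> complex \<Rightarrow> complex \<Rightarrow> nat \<Rightarrow> complex" where
  "gauss_coeffs a b c q u v 0 = u"
| "gauss_coeffs a b c q u v (Suc 0) = v"
| "gauss_coeffs a b c q u v (Suc (Suc n)) =
     ((of_nat n + a) * (of_nat n + b) * gauss_coeffs a b c q u v n
       - (of_nat n + 1) * ((1 - 2 * q) * of_nat n + c - (a + b + 1) * q) * gauss_coeffs a b c q u v (Suc n))
     / (q * (1 - q) * (of_nat n + 2) * (of_nat n + 1))"

text \<open>
  Induction along the recurrence. The assumption \<open>1 \<le> K\<close> allows \<open>K ^ n\<close> to be replaced by \<open>K ^ Suc n\<close>, so that both
  preceding coefficients are estimated by the same power.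
\<close>

lemma gauss_coeffs_bound:
  assumes q: "q \<noteq> 0" "q \<noteq> 1" and K: "1 \<le> K" "gauss_bound a b c q \<le> K"
  shows "norm (gauss_coeffs a b c q u v n) \<le> (norm u + norm v) * K ^ n"
proof (induction n rule: induct_nat_012)
  case 0
  show ?case by simp
next
  case 1
  have "norm v \<le> (norm u + norm v) * 1" by simp
  also have "\<dots> \<le> (norm u + norm v) * K" using K by (intro mult_left_mono) auto
  finally show ?case by simp
next
  case (ge2 n)
  define M where "M = norm u + norm v"
  define U where "U = gauss_coeffs a b c q u v"
  define p where "p = norm (q * (1 - q))"
  define x where "x = real n"
  have x: "x \<ge> 0" by (simp add: x_def)
  have M: "M \<ge> 0" by (simp add: M_def)
  have p: "p > 0" using q by (simp add: p_def)
  have nx: "norm (of_nat n + d :: complex) \<le> (x + 1) * (1 + norm d)" for d :: complex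
  proof -
    have "norm (of_nat n + d) \<le> x + norm d"
      using norm_triangle_ineq[of "of_nat n" d] by (simp add: x_def)
    also have "\<dots> \<le> (x + 1) * (1 + norm d)" using x by (simp add: algebra_simps)
    finally show ?thesis .
  qed
  have n12: "norm (of_nat n + 1 :: complex) = x + 1" "norm (of_nat n + 2 :: complex) = x + 2"
    using norm_of_nat[of "n + 1", where ?'a = complex] norm_of_nat[of "n + 2", where ?'a = complex] by (simp_all add: x_def add_ac)
  define B where "B = norm (1 - 2 * q) + norm (c - (a + b + 1) * q)"
  have t1: "norm ((of_nat n + a) * (of_nat n + b) * U n) \<le> ((x + 1) * (x + 2)) * ((1 + norm a) * (1 + norm b) * (M * K ^ Suc n))"
  proof -
    have "norm ((of_nat n + a) * (of_nat n + b) * U n) \<le> ((x + 1) * (1 + norm a)) * ((x + 1) * (1 + norm b)) * (M * K ^ n)"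
      unfolding norm_mult using ge2(1) x by (intro mult_mono nx) (auto simp: M_def U_def)
    also have "\<dots> \<le> ((x + 1) * (1 + norm a)) * ((x + 2) * (1 + norm b)) * (M * K ^ Suc n)"
      using x M K by (intro mult_mono) auto
    finally show ?thesis by (simp add: mult_ac)
  qed
  have t2: "norm ((of_nat n + 1) * ((1 - 2 * q) * of_nat n + c - (a + b + 1) * q) * U (Suc n))
     \<le> ((x + 1) * (x + 2)) * (B * (M * K ^ Suc n))"
  proof -
    have "norm ((1 - 2 * q) * of_nat n + c - (a + b + 1) * q) \<le> norm (1 - 2 * q) * x + norm (c - (a + b + 1) * q)"
      using norm_triangle_ineq[of "(1 - 2 * q) * of_nat n" "c - (a + b + 1) * q"]
      unfolding add_diff_eq norm_mult by (simp add: x_def)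
    also have "\<dots> \<le> (x + 2) * B"
      using x by (simp add: B_def algebra_simps)
    finally have "norm ((of_nat n + 1) * ((1 - 2 * q) * of_nat n + c - (a + b + 1) * q) * U (Suc n))
       \<le> (x + 1) * ((x + 2) * B) * (M * K ^ Suc n)"
      unfolding norm_mult n12 using ge2(2) x by (intro mult_mono) (auto simp: M_def U_def B_def)
    then show ?thesis by (simp add: mult_ac)
  qed
  have "norm (U (Suc (Suc n))) = norm ((of_nat n + a) * (of_nat n + b) * U n
       - (of_nat n + 1) * ((1 - 2 * q) * of_nat n + c - (a + b + 1) * q) * U (Suc n))
        / (p * (x + 2) * (x + 1))"
    unfolding U_def gauss_coeffs.simps norm_divide norm_mult[of _ "of_nat n + 1"]
      norm_mult[of _ "of_nat n + 2"] n12 p_def ..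
  also have "\<dots> \<le> (((x + 1) * (x + 2)) * ((1 + norm a) * (1 + norm b) * (M * K ^ Suc n)) +
       ((x + 1) * (x + 2)) * (B * (M * K ^ Suc n))) / (p * (x + 2) * (x + 1))"
    using x p by (intro divide_right_mono order_trans[OF norm_triangle_ineq4] add_mono t1 t2) auto
  also have "\<dots> = gauss_bound a b c q * (M * K ^ Suc n)"
    using x p unfolding gauss_bound_def p_def[symmetric] B_def
    by (simp add: divide_simps) (simp add: algebra_simps)
  also have "\<dots> \<le> K * (M * K ^ Suc n)"
    using K M by (intro mult_right_mono) auto
  finally show ?case by (simp add: M_def U_def mult_ac)
qed

lemma gauss_solution_exists:
  assumes q: "q \<noteq> 0" "q \<noteq> 1" and K: "1 \<le> K" "gauss_bound a b c q \<le> K"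
  obtains f where "gauss_solution a b c f (ball q (1 / K))" "f q = u" "deriv f q = v"
proof -
  define F where "F = Abs_fps (gauss_coeffs a b c q u v)"
  have rec: "gauss_recurrence a b c q F"
    unfolding gauss_recurrence_def
  proof
    fix n
    have "of_nat n + 2 \<noteq> (0 :: complex)" "of_nat n + 1 \<noteq> (0 :: complex)"
      using of_nat_neq_0[of n, where ?'a = complex] of_nat_neq_0[of "Suc n", where ?'a = complex] by (auto simp: add_ac)
    then show "q * (1 - q) * (of_nat n + 2) * (of_nat n + 1) * fps_nth F (n + 2) +
     (of_nat n + 1) * ((1 - 2 * q) * of_nat n + c - (a + b + 1) * q) * fps_nth F (n + 1) =
     (of_nat n + a) * (of_nat n + b) * fps_nth F n"
      using q by (simp add: F_def)
  qed
  have rad: "ereal (1 / K) \<le> fps_conv_radius F"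
    unfolding fps_conv_radius_def
  proof (rule conv_radius_geI_ex)
    fix r :: real assume r: "0 < r" "ereal r < ereal (1 / K)"
    have rK: "K * r < 1" using r K by (simp add: field_simps)
    have "summable (\<lambda>n. fps_nth F n * of_real r ^ n)"
    proof (rule summable_comparison_test)
      show "summable (\<lambda>n. (norm u + norm v) * (K * r) ^ n)"
        using rK r K by (intro summable_mult summable_geometric) auto
      show "\<exists>N. \<forall>n\<ge>N. norm (fps_nth F n * of_real r ^ n) \<le> (norm u + norm v) * (K * r) ^ n"
      proof (intro exI allI impI)
        fix n
        have "norm (fps_nth F n * of_real r ^ n) = norm (gauss_coeffs a b c q u v n) * r ^ n"
          using r by (simp add: F_def norm_mult norm_power)
        also have "\<dots> \<le> (norm u + norm v) * K ^ n * r ^ n"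
          using gauss_coeffs_bound[OF q K] r by (intro mult_right_mono) auto
        finally show "norm (fps_nth F n * of_real r ^ n) \<le> (norm u + norm v) * (K * r) ^ n"
          by (simp add: power_mult_distrib mult_ac)
      qed
    qed
    then show "\<exists>z. norm z = r \<and> summable (\<lambda>n. fps_nth F n * z ^ n)"
      using r by (intro exI[of _ "of_real r"]) simp
  qed
  have pos: "fps_conv_radius F > 0"
    using rad K by (intro less_le_trans[OF _ rad]) auto
  show thesis
  proof (rule that)
    show "gauss_solution a b c (\<lambda>z. eval_fps F (z - q)) (ball q (1 / K))"
      by (rule gauss_solution_eval_fps[OF rec rad])
    show "eval_fps F (q - q) = u"
      by (simp add: eval_fps_at_0 F_def)
    have "(eval_fps F has_field_derivative eval_fps (fps_deriv F) (q - q)) (at (q - q))"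
      using pos by (intro has_field_derivative_eval_fps) (auto simp: zero_ereal_def)
    then have "((\<lambda>z. eval_fps F (z - q)) has_field_derivative eval_fps (fps_deriv F) (q - q) * 1) (at q)"
      by (rule DERIV_chain2) (auto intro!: derivative_eq_intros)
    then show "deriv (\<lambda>z. eval_fps F (z - q)) q = v"
      using DERIV_imp_deriv by (fastforce simp: eval_fps_at_0 F_def)
  qed
qed

section \<open>Transformations of the Gauss function\<close>

text \<open>
  The chain rule sorts the coefficients of \<open>F\<close>, \<open>F'\<close>, \<open>F''\<close> after the substitution. The hypotheses say that these
  are \<open>k\<close> times the coefficients of the equation that \<open>F\<close> satisfies at the point \<open>z x\<close>. The
  prefactor enters through its logarithmic derivative \<open>l\<close> only, so everything left to check in an
  application is a rational identity.
\<close>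

lemma gauss_solution_pullback:
  assumes c: "c \<notin> \<int>\<^sub>\<le>\<^sub>0" and S: "open S"
    and u: "\<And>x. x \<in> S \<Longrightarrow> (u has_field_derivative l x * u x) (at x)"
    and l: "\<And>x. x \<in> S \<Longrightarrow> (l has_field_derivative l' x) (at x)"
    and z: "\<And>x. x \<in> S \<Longrightarrow> (z has_field_derivative z' x) (at x)"
    and z': "\<And>x. x \<in> S \<Longrightarrow> (z' has_field_derivative z'' x) (at x)"
    and z1: "\<And>x. x \<in> S \<Longrightarrow> norm (z x) < 1"
    and k: "\<And>x. x \<in> S \<Longrightarrow> x * (1 - x) * (z' x)\<^sup>2 = k x * (z x * (1 - z x))"
    and e1: "\<And>x. x \<in> S \<Longrightarrow> x * (1 - x) * (2 * l x * z' x + z'' x) + (c' - (a' + b' + 1) * x) * z' x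
        = k x * (c - (a + b + 1) * z x)"
    and e0: "\<And>x. x \<in> S \<Longrightarrow> x * (1 - x) * ((l x)\<^sup>2 + l' x) + (c' - (a' + b' + 1) * x) * l x - a' * b'
        = - k x * (a * b)"
  shows "gauss_solution a' b' c' (\<lambda>x. u x * hyp2F1 a b c (z x)) S"
proof -
  define F where "F = hyp2F1 a b c"
  have sol: "gauss_solution a b c F (ball 0 1)"
    unfolding F_def by (rule gauss_solution_hyp2F1[OF c])
  then have F: "F holomorphic_on ball 0 1" by (simp add: gauss_solution_def)
  then have F': "deriv F holomorphic_on ball 0 1" by (intro holomorphic_deriv) auto
  have dF: "((\<lambda>x. F (z x)) has_field_derivative deriv F (z x) * z' x) (at x)" if "x \<in> S" for x
    using holomorphic_derivI[OF F open_ball, of "z x"] z[OF that] z1[OF that]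
    by (intro DERIV_chain2[of F _ z]) auto
  have dF': "((\<lambda>x. deriv F (z x)) has_field_derivative deriv (deriv F) (z x) * z' x) (at x)" if "x \<in> S" for x
    using holomorphic_derivI[OF F' open_ball, of "z x"] z[OF that] z1[OF that]
    by (intro DERIV_chain2[of "deriv F" _ z]) auto
  show ?thesis
    unfolding F_def[symmetric]
  proof (rule gauss_solutionI[OF S, where
      g = "\<lambda>x. u x * (l x * F (z x) + z' x * deriv F (z x))" and
      h = "\<lambda>x. u x * (((l x)\<^sup>2 + l' x) * F (z x) + (2 * l x * z' x + z'' x) * deriv F (z x)
           + (z' x)\<^sup>2 * deriv (deriv F) (z x))"])
    fix x assume x: "x \<in> S"
    show "((\<lambda>x. u x * F (z x)) has_field_derivative u x * (l x * F (z x) + z' x * deriv F (z x))) (at x)"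
      by (rule DERIV_cong, (rule derivative_intros u[OF x] dF[OF x])+) (simp add: algebra_simps)
    show "((\<lambda>x. u x * (l x * F (z x) + z' x * deriv F (z x))) has_field_derivative
        u x * (((l x)\<^sup>2 + l' x) * F (z x) + (2 * l x * z' x + z'' x) * deriv F (z x)
           + (z' x)\<^sup>2 * deriv (deriv F) (z x))) (at x)"
      by (rule DERIV_cong, (rule derivative_intros u[OF x] dF[OF x] dF'[OF x] l[OF x] z'[OF x])+)
        (simp add: algebra_simps power2_eq_square)
    define f0 f1 f2 where "f0 = F (z x)" "f1 = deriv F (z x)" "f2 = deriv (deriv F) (z x)"
    have ode: "z x * (1 - z x) * f2 + (c - (a + b + 1) * z x) * f1 - a * b * f0 = 0"
      using sol z1[OF x] by (simp add: gauss_solution_def f0_f1_f2_def)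
    have "x * (1 - x) * (u x * (((l x)\<^sup>2 + l' x) * f0 + (2 * l x * z' x + z'' x) * f1 + (z' x)\<^sup>2 * f2))
        + (c' - (a' + b' + 1) * x) * (u x * (l x * f0 + z' x * f1)) - a' * b' * (u x * f0)
      = u x * ((x * (1 - x) * ((l x)\<^sup>2 + l' x) + (c' - (a' + b' + 1) * x) * l x - a' * b') * f0
          + (x * (1 - x) * (2 * l x * z' x + z'' x) + (c' - (a' + b' + 1) * x) * z' x) * f1
          + (x * (1 - x) * (z' x)\<^sup>2) * f2)"
      by (simp add: algebra_simps)
    also have "\<dots> = u x * (k x * (z x * (1 - z x) * f2 + (c - (a + b + 1) * z x) * f1 - a * b * f0))"
      unfolding k[OF x] e1[OF x] e0[OF x] by (simp add: algebra_simps)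
    also have "\<dots> = 0" unfolding ode by simp
    finally show "x * (1 - x) * (u x * (((l x)\<^sup>2 + l' x) * F (z x) + (2 * l x * z' x + z'' x) * deriv F (z x)
           + (z' x)\<^sup>2 * deriv (deriv F) (z x))) + (c' - (a' + b' + 1) * x) *
           (u x * (l x * F (z x) + z' x * deriv F (z x))) - a' * b' * (u x * F (z x)) = 0"
      by (simp add: f0_f1_f2_def)
  qed
qed

text \<open>
  The derivative is written as a multiple of the function, the shape in which prefactors enter
  \<open>gauss_solution_pullback\<close>.
\<close>

lemma powr_linear_deriv:
  fixes k p x :: complex
  assumes "norm (k * x) < 1"
  shows "((\<lambda>x. (1 - k * x) powr p) has_field_derivative (- (k * p) / (1 - k * x)) * (1 - k * x) powr p) (at x)"
proof -
  have "Re (k * x) < 1"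
    using assms complex_Re_le_cmod[of "k * x"] by simp
  then have "1 - k * x \<notin> \<real>\<^sub>\<le>\<^sub>0" "1 - k * x \<noteq> 0"
    by (auto simp: complex_nonpos_Reals_iff complex_eq_iff)
  then show ?thesis
    by (auto intro!: derivative_eq_intros simp: powr_diff)
qed

lemma hyp2F1_0_left: "hyp2F1 0 b c z = 1"
proof -
  have "gauss_series 0 b c = 1"
    by (rule fps_ext) (simp add: gauss_series_nth pochhammer_0_left)
  then show ?thesis by (simp add: hyp2F1_def)
qed

lemma hyp2F1_at_0: "hyp2F1 a b c 0 = 1"
  by (simp add: hyp2F1_def eval_fps_at_0)

text \<open>
  Makes the continuation of powers a special case of the continuation of Gauss functions. The constant
  factor \<open>F(0, 1; 1; 0) = 1\<close> in the proof brings the power into the form \<open>u(x) F(z(x))\<close>.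
\<close>

lemma powr_eq_hyp2F1:
  assumes "norm x < 1"
  shows "(1 - x) powr p = hyp2F1 (- p) 1 1 x"
proof -
  have ne: "1 - x \<noteq> 0" if "norm x < 1" for x :: complex using that by auto
  have "gauss_solution (- p) 1 1 (\<lambda>x. (1 - 1 * x) powr p * hyp2F1 0 1 1 0) (ball 0 1)"
  proof (rule gauss_solution_pullback[where l = "\<lambda>x. - (1 * p) / (1 - 1 * x)" and l' = "\<lambda>x. - p / (1 - x)\<^sup>2"
          and z = "\<lambda>x. 0" and z' = "\<lambda>x. 0" and z'' = "\<lambda>x. 0" and k = "\<lambda>x. 0"], goal_cases)
    case (3 x)
    then show ?case by (intro powr_linear_deriv) auto
  next
    case (4 x)
    then show ?case using ne[of x]
      by (auto intro!: derivative_eq_intros simp: power2_eq_square)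
  next
    case (10 x)
    then show ?case using ne[of x]
      by (auto simp: divide_simps) (auto simp: power2_eq_square algebra_simps)
  qed auto
  from gauss_solution_at_0_unique[OF this, of x] show ?thesis
    using assms by (simp add: hyp2F1_0_left)
qed

text \<open>
  Both sides solve the same equation and are 1 at 0. The radius 1/2 ensures \<open>norm (w / (w - 1)) < 1\<close>.
\<close>

lemma pfaff_transformation:
  assumes c: "c \<notin> \<int>\<^sub>\<le>\<^sub>0" and "norm w < 1/2"
  shows "hyp2F1 a b c w = (1 - w) powr (- a) * hyp2F1 a (c - b) c (w / (w - 1))"
proof -
  have ne: "1 - w \<noteq> 0" "w - 1 \<noteq> 0" "norm (w / (w - 1)) < 1" if "norm w < 1/2" for w :: complex
  proof -
    show 1: "w - 1 \<noteq> 0" using that by auto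
    then show "1 - w \<noteq> 0" by auto
    have "norm (w - 1) \<ge> 1 - norm w"
      by (metis norm_minus_commute norm_one norm_triangle_ineq2)
    then show "norm (w / (w - 1)) < 1"
      using that by (auto simp: norm_divide divide_simps)
  qed
  have "gauss_solution a b c (\<lambda>x. (1 - 1 * x) powr (- a) * hyp2F1 a (c - b) c (x / (x - 1))) (ball 0 (1/2))"
  proof (rule gauss_solution_pullback[OF c, where l = "\<lambda>x. - (1 * (- a)) / (1 - 1 * x)" and l' = "\<lambda>x. a / (1 - x)\<^sup>2"
          and z' = "\<lambda>x. - 1 / (1 - x)\<^sup>2" and z'' = "\<lambda>x. - 2 / (1 - x)^3" and k = "\<lambda>x. - 1 / (1 - x)"], goal_cases)
    case (2 x)
    then show ?case by (intro powr_linear_deriv) auto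
  next
    case (3 x)
    then show ?case using ne[of x] by (auto intro!: derivative_eq_intros simp: power2_eq_square)
  next
    case (4 x)
    then show ?case using ne[of x]
      by (auto intro!: derivative_eq_intros simp: divide_simps) (auto simp: power2_eq_square algebra_simps)
  next
    case (5 x)
    then show ?case using ne[of x]
      by (auto intro!: derivative_eq_intros simp: divide_simps) (auto simp: power2_eq_square power3_eq_cube power4_eq_xxxx algebra_simps)
  next
    case (6 x)
    then show ?case using ne[of x] by auto
  next
    case (7 x)
    \<comment> \<open>With inverses as new variables, each rational identity becomes an ideal membership.\<close>
    define P where "P = inverse (1 - x)"
    have x: "x - 1 = - (1 - x)" by simp
    have "(1 - x) * P = 1" using 7 ne[of x] by (auto simp: P_def)
    then show ?case unfolding x divide_inverse inverse_minus_eq power_inverse[symmetric] P_def[symmetric]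
      by algebra
  next
    case (8 x)
    define P where "P = inverse (1 - x)"
    have x: "x - 1 = - (1 - x)" by simp
    have "(1 - x) * P = 1" using 8 ne[of x] by (auto simp: P_def)
    then show ?case unfolding x mult_1 divide_inverse inverse_minus_eq power_inverse[symmetric] P_def[symmetric]
      by algebra
  next
    case (9 x)
    define P where "P = inverse (1 - x)"
    have x: "x - 1 = - (1 - x)" by simp
    have "(1 - x) * P = 1" using 9 ne[of x] by (auto simp: P_def)
    then show ?case unfolding x mult_1 divide_inverse inverse_minus_eq power_inverse[symmetric] P_def[symmetric]
      by algebra
  qed auto
  from gauss_solution_at_0_unique[OF this, of w] show ?thesis
    using assms by (simp add: hyp2F1_at_0)
qed

lemma quadratic_argument_bound:
  fixes x :: complex
  assumes "norm x < 1/10"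
  shows "1 - x \<noteq> 0" "1 - 2 * x \<noteq> 0" "norm (- 4 * x * (1 - x) / (1 - 2 * x)\<^sup>2) \<le> 7 * norm x"
proof -
  have 1: "norm (1 - 2 * x) \<ge> 1 - 2 * norm x"
    using norm_triangle_ineq2[of 1 "2 * x"] by (simp add: norm_mult)
  then have 2: "norm (1 - 2 * x) \<ge> 4/5" using assms by simp
  then show "1 - 2 * x \<noteq> 0" by auto
  show "1 - x \<noteq> 0" using assms by auto
  have "(4/5)\<^sup>2 \<le> (norm (1 - 2 * x))\<^sup>2"
    using 2 by (intro power_mono) auto
  then have 3: "16/25 \<le> norm ((1 - 2 * x)\<^sup>2)" by (simp add: norm_mult power2_eq_square)
  have "norm (1 - x) \<le> 11/10"
    using norm_triangle_ineq4[of 1 x] assms by simp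
  then have "norm (- 4 * x * (1 - x)) \<le> 4 * norm x * (11/10)"
    unfolding norm_mult by (intro mult_mono) auto
  then have "norm (- 4 * x * (1 - x)) / norm ((1 - 2 * x)\<^sup>2) \<le> (4 * norm x * (11/10)) / (16/25)"
    using 3 by (intro frac_le) auto
  also have "\<dots> \<le> 7 * norm x" by simp
  finally show "norm (- 4 * x * (1 - x) / (1 - 2 * x)\<^sup>2) \<le> 7 * norm x"
    by (simp only: norm_divide)
qed

text \<open>
  Both sides solve the same equation and are 1 at 0. The radius 1/10 does not depend on \<open>d\<close>, which is
  essential: the formula is applied at a fixed point to all parameters \<open>d = c + \<nu>\<close> at once.
\<close>

lemma quadratic_transformation:
  assumes d: "d \<notin> \<int>\<^sub>\<le>\<^sub>0" and x: "norm x < 1/10" and N: "N = d - b"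
  shows "hyp2F1 b (1 - b) d x = (1 - x) powr (d - 1) * (1 - 2 * x) powr (- N) *
     hyp2F1 (N / 2) ((N + 1) / 2) d (- 4 * x * (1 - x) / (1 - 2 * x)\<^sup>2)"
proof -
  define l :: "complex \<Rightarrow> complex" where "l = (\<lambda>x. - (d - 1) / (1 - x) + 2 * N / (1 - 2 * x))"
  have u: "((\<lambda>x. (1 - 1 * x) powr (d - 1) * (1 - 2 * x) powr (- N)) has_field_derivative
     l x * ((1 - 1 * x) powr (d - 1) * (1 - 2 * x) powr (- N))) (at x)" if "norm x < 1/10" for x
    by (rule DERIV_cong, rule DERIV_mult, rule powr_linear_deriv, use that in simp,
        rule powr_linear_deriv, use that in \<open>simp add: norm_mult\<close>)
      (simp add: l_def algebra_simps)
  have "gauss_solution b (1 - b) d (\<lambda>x. ((1 - 1 * x) powr (d - 1) * (1 - 2 * x) powr (- N)) *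
     hyp2F1 (N / 2) ((N + 1) / 2) d (- 4 * x * (1 - x) / (1 - 2 * x)\<^sup>2)) (ball 0 (1/10))"
  proof (rule gauss_solution_pullback[OF d, where l = l and l' = "\<lambda>x. - (d - 1) / (1 - x)\<^sup>2 + 4 * N / (1 - 2 * x)\<^sup>2"
          and z' = "\<lambda>x. - 4 / (1 - 2 * x)^3" and z'' = "\<lambda>x. - 24 / (1 - 2 * x)^4"
          and k = "\<lambda>x. - 4 / (1 - 2 * x)\<^sup>2"], goal_cases)
    case (2 x)
    then show ?case by (intro u) auto
  next
    case (3 x)
    then show ?case using quadratic_argument_bound[of x] unfolding l_def
      by (auto intro!: derivative_eq_intros simp: power2_eq_square)
  next
    case (4 x)
    then have "(1 - 2 * x) \<noteq> 0" using quadratic_argument_bound[of x] by auto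
    then show ?case 
      by (auto intro!: derivative_eq_intros simp: divide_simps) (simp add: power2_eq_square power3_eq_cube power4_eq_xxxx algebra_simps)
  next
    case (5 x)
    then have "(1 - 2 * x) \<noteq> 0" using quadratic_argument_bound[of x] by auto
    then show ?case
      by (auto intro!: derivative_eq_intros simp: divide_simps)
  next
    case (6 x)
    then show ?case using quadratic_argument_bound(3)[of x] by auto
  next
    case (7 x)
    define Q where "Q = inverse (1 - 2 * x)"
    have "(1 - 2 * x) * Q = 1" using 7 quadratic_argument_bound[of x] by (auto simp: Q_def)
    then show ?case unfolding divide_inverse power_inverse[symmetric] Q_def[symmetric]
      by algebra
  next
    case (8 x)
    define P where "P = inverse (1 - x)"
    define Q where "Q = inverse (1 - 2 * x)"
    have "(1 - x) * P = 1" using 8 quadratic_argument_bound[of x] by (auto simp: P_def)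
    moreover have "(1 - 2 * x) * Q = 1" using 8 quadratic_argument_bound[of x] by (auto simp: Q_def)
    moreover define H where "H = inverse (2 :: complex)"
    moreover have "2 * H = 1" by (simp add: H_def)
    ultimately show ?case using N unfolding l_def divide_inverse power_inverse[symmetric] P_def[symmetric] Q_def[symmetric] H_def[symmetric]
      by algebra
  next
    case (9 x)
    define P where "P = inverse (1 - x)"
    define Q where "Q = inverse (1 - 2 * x)"
    have "(1 - x) * P = 1" using 9 quadratic_argument_bound[of x] by (auto simp: P_def)
    moreover have "(1 - 2 * x) * Q = 1" using 9 quadratic_argument_bound[of x] by (auto simp: Q_def)
    moreover define H where "H = inverse (2 :: complex)"
    moreover have "2 * H = 1" by (simp add: H_def)
    ultimately show ?case using N unfolding l_def divide_inverse power_inverse[symmetric] P_def[symmetric] Q_def[symmetric] H_def[symmetric]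
      by algebra
  qed auto
  from gauss_solution_at_0_unique[OF this, of x] show ?thesis
    using assms by (simp add: hyp2F1_at_0)
qed

section \<open>A terminating sum of Whipple's type\<close>

lemma sum_binomial_Suc:
  fixes h :: "nat \<Rightarrow> 'a :: comm_ring_1"
  shows "(\<Sum>\<nu>\<le>Suc n. of_nat (Suc n choose \<nu>) * h \<nu>) = (\<Sum>\<nu>\<le>n. of_nat (n choose \<nu>) * (h \<nu> + h (Suc \<nu>)))"
proof -
  have "(\<Sum>\<nu>\<le>Suc n. of_nat (Suc n choose \<nu>) * h \<nu>)
    = (\<Sum>\<nu>\<le>n. of_nat (n choose \<nu>) * h (Suc \<nu>)) + (h 0 + (\<Sum>\<nu>\<le>n. of_nat (n choose Suc \<nu>) * h (Suc \<nu>)))"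
    by (subst sum.atMost_Suc_shift) (simp add: sum.distrib algebra_simps)
  also have "h 0 + (\<Sum>\<nu>\<le>n. of_nat (n choose Suc \<nu>) * h (Suc \<nu>)) = (\<Sum>\<nu>\<le>Suc n. of_nat (n choose \<nu>) * h \<nu>)"
    by (subst sum.atMost_Suc_shift) simp
  also have "\<dots> = (\<Sum>\<nu>\<le>n. of_nat (n choose \<nu>) * h \<nu>)"
    by (simp add: binomial_eq_0)
  finally show ?thesis by (simp add: sum.distrib algebra_simps)
qed

text \<open>
  Up to the factor \<open>pochhammer N (2 * n)\<close> the left-hand side is, for generic \<open>N\<close>,
  \<open>3F2(-n, b, 1 - b; N, 1 - N - 2 n; 1)\<close>, a case of Whipple's summation theorem. The proof is by
  induction on \<open>n\<close>: after Pascal's rule, the difference between the sum for \<open>n + 1\<close> and the expected multiple of the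
  sum for \<open>n\<close> telescopes.
\<close>

lemma whipple_sum:
  fixes b N :: complex
  shows "(\<Sum>\<nu>\<le>n. of_nat (n choose \<nu>) * (pochhammer b \<nu> * pochhammer (1 - b) \<nu> * pochhammer (N + of_nat \<nu>) (2 * (n - \<nu>))))
    = (\<Prod>j<n. b * (1 - b) + (N + 2 * of_nat j) * (N + 2 * of_nat j + 1))"
proof (induction n)
  case 0
  show ?case by simp
next
  case (Suc n)
  define g where "g \<nu> = pochhammer b \<nu> * pochhammer (1 - b) \<nu>" for \<nu>
  define s where "s = b * (1 - b)"
  have g: "g (Suc \<nu>) = (s + of_nat \<nu> * (of_nat \<nu> + 1)) * g \<nu>" for \<nu>
    by (simp add: g_def s_def pochhammer_Suc algebra_simps)
  define h where "h \<nu> = g \<nu> * pochhammer (N + of_nat \<nu>) (2 * (Suc n - \<nu>))" for \<nu>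
  define q where "q = s + (N + 2 * of_nat n) * (N + 2 * of_nat n + 1)"
  define T where "T \<nu> = g \<nu> * pochhammer (N + of_nat \<nu>) (2 * (n - \<nu>))" for \<nu>
  \<comment> \<open>The telescoping certificate: it vanishes at \<open>0\<close> because of the factor \<open>\<nu>\<close>, and at \<open>n + 1\<close> because of the binomial coefficient.\<close>
  define E where "E \<nu> = 2 * of_nat \<nu> * of_nat (n choose \<nu>) * g \<nu> * pochhammer (N + of_nat \<nu>) (2 * (n - \<nu>) + 1)" for \<nu>
  have tele: "of_nat (n choose \<nu>) * (h \<nu> + h (Suc \<nu>)) - q * (of_nat (n choose \<nu>) * T \<nu>) = E (Suc \<nu>) - E \<nu>"
    if "\<nu> \<le> n" for \<nu>
  proof (cases "\<nu> = n")
    case True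
    show ?thesis
      unfolding True h_def T_def E_def q_def g
      by (simp add: pochhammer_Suc numeral_2_eq_2 binomial_eq_0) (simp add: algebra_simps)
  next
    case False
    define k where "k = n - Suc \<nu>"
    have n: "n = Suc (\<nu> + k)" using that False by (simp add: k_def)
    \<comment> \<open>All Pochhammer symbols in sight share the factor \<open>R\<close>; once it is split off, the claim is a polynomial identity.\<close>
    define y where "y = N + of_nat \<nu>"
    define R where "R = pochhammer (y + 1) (2 * k + 1)"
    define m where "m = (of_nat \<nu> :: complex)"
    define C where "C = (of_nat (n choose \<nu>) :: complex)"
    define kk where "kk = (of_nat k :: complex)"
    have R1: "pochhammer y (2 * k + 2) = y * R"
      using pochhammer_rec[of y "2 * k + 1"] by (simp add: R_def)
    have R2: "pochhammer y (2 * k + 3) = y * R * (y + 2 * kk + 2)"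
      using pochhammer_Suc[of y "2 * k + 2"] R1 by (simp add: eval_nat_numeral kk_def algebra_simps)
    have R3: "pochhammer y (2 * k + 4) = y * R * (y + 2 * kk + 2) * (y + 2 * kk + 3)"
      using pochhammer_Suc[of y "2 * k + 3"] R2 by (simp add: eval_nat_numeral kk_def algebra_simps)
    have R4: "pochhammer (y + 1) (2 * k + 2) = R * (y + 2 * kk + 2)"
      using pochhammer_Suc[of "y + 1" "2 * k + 1"] by (simp add: R_def kk_def algebra_simps)
    have "Suc \<nu> * (n choose Suc \<nu>) = (n - \<nu>) * (n choose \<nu>)"
      by (metis Suc_times_binomial_eq binomial_absorb_comp n diff_Suc_1 that mult.commute binomial_absorption)
    then have "of_nat (Suc \<nu> * (n choose Suc \<nu>)) = (of_nat ((n - \<nu>) * (n choose \<nu>)) :: complex)"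
      by (rule arg_cong)
    then have C': "(m + 1) * of_nat (n choose Suc \<nu>) = (kk + 1) * C"
      by (simp add: n m_def C_def kk_def algebra_simps)
    have E2: "E (Suc \<nu>) = 2 * ((kk + 1) * C) * ((s + m * (m + 1)) * g \<nu>) * R"
      unfolding C'[symmetric] E_def g by (simp add: n R_def y_def m_def kk_def C_def add_ac mult_ac)
    have lengths: "2 * (Suc n - \<nu>) = 2 * k + 4" "2 * (Suc n - Suc \<nu>) = 2 * k + 2"
        "2 * (n - \<nu>) = 2 * k + 2" "2 * (n - \<nu>) + 1 = 2 * k + 3"
      by (simp_all add: n)
    have y1: "N + of_nat (Suc \<nu>) = y + 1" by (simp add: y_def)
    have "h \<nu> = g \<nu> * (y * R * (y + 2 * kk + 2) * (y + 2 * kk + 3))"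
      unfolding h_def lengths y_def[symmetric] R3 ..
    moreover have "h (Suc \<nu>) = (s + m * (m + 1)) * g \<nu> * (R * (y + 2 * kk + 2))"
      unfolding h_def lengths y1 R4 g m_def[symmetric] ..
    moreover have "T \<nu> = g \<nu> * (y * R)"
      unfolding T_def lengths y_def[symmetric] R1 ..
    moreover have "E \<nu> = 2 * m * C * g \<nu> * (y * R * (y + 2 * kk + 2))"
      unfolding E_def lengths(4) y_def[symmetric] R2 by (simp add: m_def C_def)
    ultimately have eqs: "h \<nu> = g \<nu> * (y * R * (y + 2 * kk + 2) * (y + 2 * kk + 3))"
        "h (Suc \<nu>) = (s + m * (m + 1)) * g \<nu> * (R * (y + 2 * kk + 2))"
        "T \<nu> = g \<nu> * (y * R)" "E \<nu> = 2 * m * C * g \<nu> * (y * R * (y + 2 * kk + 2))" by blast+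
    have Nn: "q = s + (y - m + 2 * (m + kk + 1)) * (y - m + 2 * (m + kk + 1) + 1)"
      by (simp add: q_def y_def m_def kk_def n)
    show ?thesis
      unfolding C_def[symmetric] E2 eqs Nn by (simp add: algebra_simps)
  qed
  have "(\<Sum>\<nu>\<le>Suc n. of_nat (Suc n choose \<nu>) * h \<nu>) - q * (\<Sum>\<nu>\<le>n. of_nat (n choose \<nu>) * T \<nu>)
     = (\<Sum>\<nu>\<le>n. of_nat (n choose \<nu>) * (h \<nu> + h (Suc \<nu>)) - q * (of_nat (n choose \<nu>) * T \<nu>))"
    unfolding sum_binomial_Suc by (simp add: sum_subtractf sum_distrib_left)
  also have "\<dots> = (\<Sum>\<nu>\<le>n. E (Suc \<nu>) - E \<nu>)"
    using tele by (intro sum.cong) auto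
  also have "\<dots> = E (Suc n) - E 0"
    unfolding lessThan_Suc_atMost[symmetric] by (rule sum_lessThan_telescope)
  also have "\<dots> = 0" by (simp add: E_def)
  finally show ?case
    using Suc.IH unfolding h_def T_def g_def q_def s_def by (simp add: mult_ac)
qed

section \<open>The reduction of the Appell series near the origin\<close>

text \<open>
  Crude bounds suffice here: the reduction is needed only on some neighbourhood of the origin, however small.
  Each factor satisfies \<open>norm (a + j) \<le> (1 + norm a) * (1 + j)\<close>.
\<close>

lemma norm_pochhammer_shifted_le:
  fixes a :: complex
  shows "norm (pochhammer (a + of_nat m) n) * fact m \<le> (1 + norm a) ^ n * fact (m + n)"
proof (induction n)
  case 0
  show ?case by simp
next
  case (Suc n)
  have "norm (a + of_nat m + of_nat n) \<le> norm a + real (m + n)"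
    using norm_triangle_ineq[of a "of_nat (m + n)"] by (simp add: add_ac del: of_nat_add) (simp add: add_ac)
  also have "\<dots> \<le> (1 + norm a) * (1 + real (m + n))"
    by (simp add: algebra_simps del: of_nat_add)
  finally have "(norm (pochhammer (a + of_nat m) n) * fact m) * norm (a + of_nat m + of_nat n)
    \<le> ((1 + norm a) ^ n * fact (m + n)) * ((1 + norm a) * (1 + real (m + n)))"
    by (rule mult_mono[OF Suc.IH]) auto
  then show ?case by (simp add: pochhammer_Suc norm_mult mult_ac)
qed

lemma norm_pochhammer_le: "norm (pochhammer a n) \<le> (1 + norm a) ^ n * fact n" for a :: complex
  using norm_pochhammer_shifted_le[of a 0 n] by simp

text \<open>
  The quotients \<open>(j + 1) / (c + j)\<close> are defined for all \<open>j\<close> and converge to 1, hence are bounded.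
\<close>

lemma norm_pochhammer_ge:
  fixes c :: complex
  assumes "c \<notin> \<int>\<^sub>\<le>\<^sub>0"
  obtains K where "K > 0" "\<And>n. fact n \<le> K ^ n * norm (pochhammer c n)"
proof -
  have "(\<lambda>n. 1 / (1 + (c - 1) * (1 / of_nat (Suc n)))) \<longlonglongrightarrow> 1 / (1 + (c - 1) * 0)"
    by (intro tendsto_intros LIMSEQ_Suc[OF lim_1_over_n]) auto
  then have "Bseq (\<lambda>n. 1 / (1 + (c - 1) * (1 / of_nat (Suc n))))"
    by (intro convergent_imp_Bseq) (auto simp: convergent_def)
  then obtain K where K: "K > 0" "\<And>n. norm (1 / (1 + (c - 1) * (1 / of_nat (Suc n)))) \<le> K"
    unfolding Bseq_def by blast
  have le: "real (Suc n) \<le> K * norm (c + of_nat n)" for n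
  proof -
    have "1 + (c - 1) * (1 / of_nat (Suc n)) = (c + of_nat n) / of_nat (Suc n)"
      using of_nat_neq_0[of n, where ?'a = complex] by (simp add: divide_simps del: of_nat_Suc) simp
    then have "real (Suc n) / norm (c + of_nat n) \<le> K"
      using K(2)[of n] by (simp add: norm_divide del: of_nat_Suc)
    then show ?thesis
      using shifted_nonzero[OF assms, of n] by (simp add: pos_divide_le_eq)
  qed
  have "fact n \<le> K ^ n * norm (pochhammer c n)" for n
  proof (induction n)
    case 0
    show ?case by simp
  next
    case (Suc n)
    have "real (Suc n) * fact n \<le> (K * norm (c + of_nat n)) * (K ^ n * norm (pochhammer c n))"
      using Suc le K(1) by (intro mult_mono) auto
    then show ?case by (simp add: pochhammer_Suc norm_mult mult_ac)
  qed
  with K(1) show thesis by (rule that)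
qed

lemma summable_on_geometric_bound:
  fixes f :: "nat \<times> nat \<Rightarrow> complex"
  assumes "\<And>m n. norm (f (m, n)) \<le> p ^ m * q ^ n" and "0 \<le> p" "p < 1" "0 \<le> q" "q < 1"
  shows "f summable_on UNIV"
proof -
  have geo: "((\<lambda>n. t ^ n) has_sum (1 / (1 - t))) UNIV" if "0 \<le> t" "t < 1" for t :: real
    using that by (intro norm_summable_imp_has_sum geometric_sums) (auto intro!: summable_geometric)
  have "(\<lambda>mn. p ^ fst mn * q ^ snd mn) summable_on (UNIV :: nat set) \<times> (UNIV :: nat set)"
  proof (rule summable_on_SigmaI)
    show "((\<lambda>n. p ^ fst (m, n) * q ^ snd (m, n)) has_sum p ^ m * (1 / (1 - q))) UNIV" for m :: nat
      using has_sum_cmult_right[OF geo[of q], of "p ^ m"] assms by simp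
    show "(\<lambda>m. p ^ m * (1 / (1 - q))) summable_on UNIV"
      using has_sum_cmult_left[OF geo[of p], of "1 / (1 - q)"] assms by (auto simp: summable_on_def)
  qed (use assms in auto)
  then have "(\<lambda>mn. p ^ fst mn * q ^ snd mn) summable_on (UNIV :: (nat \<times> nat) set)" by simp
  then have "(\<lambda>mn. norm (p ^ fst mn * q ^ snd mn)) summable_on (UNIV :: (nat \<times> nat) set)"
    using assms by (simp add: abs_mult)
  then have "(\<lambda>mn. norm (f mn)) summable_on UNIV"
    by (rule Infinite_Sum.abs_summable_on_comparison_test) (use assms in auto)
  then show ?thesis by (rule Infinite_Sum.abs_summable_summable)
qed

lemma has_sum_hyp2F1:
  assumes "c \<notin> \<int>\<^sub>\<le>\<^sub>0" "norm z < 1"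
  shows "((\<lambda>n. pochhammer a n * pochhammer b n / (pochhammer c n * fact n) * z ^ n) has_sum hyp2F1 a b c z) UNIV"
proof -
  have "ereal (norm z) < fps_conv_radius (gauss_series a b c)"
    using assms(2) by (intro less_le_trans[OF _ gauss_series_conv_radius[OF assms(1)]]) simp
  then show ?thesis
    unfolding hyp2F1_def using norm_summable_fps sums_eval_fps
    by (intro norm_summable_imp_has_sum) (auto simp flip: gauss_series_nth)
qed

lemma not_nonpos_Int_shift: "c + of_nat n \<notin> \<int>\<^sub>\<le>\<^sub>0" if "c \<notin> \<int>\<^sub>\<le>\<^sub>0" for c :: complex
proof
  assume "c + of_nat n \<in> \<int>\<^sub>\<le>\<^sub>0"
  then obtain m where "c + of_nat n = - of_nat m" by (auto elim: nonpos_Ints_cases')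
  then have "c + of_nat (n + m) = 0" by (simp add: eq_neg_iff_add_eq_0 add.assoc)
  then show False using shifted_nonzero[OF that] by blast
qed

text \<open>
  Both sides are the sum of one absolutely convergent double series in \<open>(\<nu>, k)\<close>. Summing over \<open>k\<close> first gives the left-hand
  side by the duplication formula for the Pochhammer symbol; summing along \<open>\<nu> + k = n\<close> gives the right-hand side
  by \<open>whipple_sum\<close>.
\<close>

lemma shifted_series_regrouped:
  fixes b c N z :: complex
  assumes c: "c \<notin> \<int>\<^sub>\<le>\<^sub>0" and z: "norm z < 1"
    and summable: "(\<lambda>(\<nu>, k). pochhammer b \<nu> * pochhammer (1 - b) \<nu> * pochhammer (N + of_nat \<nu>) (2 * k)
        / (pochhammer c (\<nu> + k) * fact \<nu> * fact k) * (z / 4) ^ (\<nu> + k)) summable_on UNIV"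
  shows "((\<lambda>\<nu>. pochhammer b \<nu> * pochhammer (1 - b) \<nu> / (pochhammer c \<nu> * fact \<nu>) * (z / 4) ^ \<nu> *
      hyp2F1 ((N + of_nat \<nu>) / 2) ((N + of_nat \<nu> + 1) / 2) (c + of_nat \<nu>) z) has_sum
      hyp2F1 ((N + b) / 2) ((N + 1 - b) / 2) c z) UNIV"
proof -
  define g where "g \<nu> = pochhammer b \<nu> * pochhammer (1 - b) \<nu>" for \<nu>
  define T where "T = (\<lambda>(\<nu>, k). g \<nu> * pochhammer (N + of_nat \<nu>) (2 * k)
        / (pochhammer c (\<nu> + k) * fact \<nu> * fact k) * (z / 4) ^ (\<nu> + k))"
  obtain E where E: "(T has_sum E) UNIV"
    using summable unfolding T_def g_def summable_on_def by blast
  have rows: "((\<lambda>k. T (\<nu>, k)) has_sum (g \<nu> / (pochhammer c \<nu> * fact \<nu>) * (z / 4) ^ \<nu> *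
      hyp2F1 ((N + of_nat \<nu>) / 2) ((N + of_nat \<nu> + 1) / 2) (c + of_nat \<nu>) z)) UNIV" for \<nu>
  proof -
    define a where "a = (N + of_nat \<nu>) / 2"
    have two_a: "2 * a = N + of_nat \<nu>" by (simp add: a_def)
    have "T (\<nu>, k) = g \<nu> / (pochhammer c \<nu> * fact \<nu>) * (z / 4) ^ \<nu> *
       (pochhammer a k * pochhammer (a + 1/2) k / (pochhammer (c + of_nat \<nu>) k * fact k) * z ^ k)" for k
    proof -
      have "pochhammer (N + of_nat \<nu>) (2 * k) = 4 ^ k * pochhammer a k * pochhammer (a + 1/2) k"
        using pochhammer_double[of a k] two_a by (simp add: power_mult)
      then show ?thesis
        by (simp add: T_def pochhammer_product'[of c \<nu> k] power_add power_divide mult_ac)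
    qed
    moreover have "(N + of_nat \<nu> + 1) / 2 = a + 1/2" by (simp add: a_def add_divide_distrib)
    ultimately show ?thesis
      unfolding a_def[symmetric]
      by (simp only:) (intro has_sum_cmult_right has_sum_hyp2F1 not_nonpos_Int_shift c z)
  qed
  have "((\<lambda>n. pochhammer ((N + b) / 2) n * pochhammer ((N + 1 - b) / 2) n / (pochhammer c n * fact n) * z ^ n)
     has_sum E) UNIV"
  proof (rule has_sum_SigmaD)
    have "(T has_sum E) UNIV \<longleftrightarrow> ((\<lambda>(n, \<nu>). T (\<nu>, n - \<nu>)) has_sum E) (Sigma UNIV (\<lambda>n. {..n}))"
      by (rule has_sum_reindex_bij_witness[where i = "\<lambda>(n, \<nu>). (\<nu>, n - \<nu>)" and j = "\<lambda>(\<nu>, k). (\<nu> + k, \<nu>)"]) auto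
    with E show "((\<lambda>(n, \<nu>). T (\<nu>, n - \<nu>)) has_sum E) (Sigma UNIV (\<lambda>n. {..n}))" by simp
    fix n :: nat
    have "(\<Sum>\<nu>\<le>n. T (\<nu>, n - \<nu>)) = (\<Sum>\<nu>\<le>n. (z / 4) ^ n / (pochhammer c n * fact n) *
        (of_nat (n choose \<nu>) * (g \<nu> * pochhammer (N + of_nat \<nu>) (2 * (n - \<nu>)))))"
      by (rule sum.cong) (auto simp: T_def binomial_fact mult_ac)
    also have "\<dots> = (z / 4) ^ n / (pochhammer c n * fact n) *
        (\<Prod>j<n. b * (1 - b) + (N + 2 * of_nat j) * (N + 2 * of_nat j + 1))"
      unfolding g_def whipple_sum[symmetric] by (simp add: sum_distrib_left)
    also have "(\<Prod>j<n. b * (1 - b) + (N + 2 * of_nat j) * (N + 2 * of_nat j + 1))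
       = (\<Prod>j<n. 4 * (((N + b) / 2 + of_nat j) * ((N + 1 - b) / 2 + of_nat j)))"
      by (rule prod.cong) (auto simp: field_simps)
    also have "\<dots> = 4 ^ n * (pochhammer ((N + b) / 2) n * pochhammer ((N + 1 - b) / 2) n)"
      by (simp add: prod.distrib pochhammer_prod atLeast0LessThan)
    finally have "(\<Sum>\<nu>\<le>n. T (\<nu>, n - \<nu>)) =
        pochhammer ((N + b) / 2) n * pochhammer ((N + 1 - b) / 2) n / (pochhammer c n * fact n) * z ^ n"
      by (simp add: power_divide)
    then show "((\<lambda>\<nu>. case (n, \<nu>) of (n, \<nu>) \<Rightarrow> T (\<nu>, n - \<nu>)) has_sum
        pochhammer ((N + b) / 2) n * pochhammer ((N + 1 - b) / 2) n / (pochhammer c n * fact n) * z ^ n) {..n}"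
      by (intro has_sum_finiteI) auto
  qed
  then have "E = hyp2F1 ((N + b) / 2) ((N + 1 - b) / 2) c z"
    using has_sum_hyp2F1[OF c z] by (rule has_sum_unique)
  moreover have "((\<lambda>\<nu>. g \<nu> / (pochhammer c \<nu> * fact \<nu>) * (z / 4) ^ \<nu> *
      hyp2F1 ((N + of_nat \<nu>) / 2) ((N + of_nat \<nu> + 1) / 2) (c + of_nat \<nu>) z) has_sum E) UNIV"
    using E by (intro has_sum_SigmaD[OF _ rows]) simp
  ultimately show ?thesis by (simp add: g_def)
qed

text \<open>
  The factorials combine to \<open>fact m * fact n / fact (m + n) \<le> 1\<close>, leaving a product of two geometric series.
\<close>

lemma appell_F3_term_summable:
  assumes "K > 0" and K: "\<And>n. fact n \<le> K ^ n * norm (pochhammer (1 - Z) n)"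
    and x: "(1 + norm (1/2 - \<alpha>)) * (1 + norm (1/2 + \<alpha>)) * K * norm x < 1"
    and y: "(1 + norm (1/2 - \<beta>)) * (1 + norm (1/2 + \<beta>)) * K * norm y < 1"
  shows "appell_F3_term \<alpha> \<beta> Z x y summable_on UNIV"
proof (rule summable_on_geometric_bound)
  let ?A = "(1 + norm (1/2 - \<alpha>)) * (1 + norm (1/2 + \<alpha>))"
  let ?B = "(1 + norm (1/2 - \<beta>)) * (1 + norm (1/2 + \<beta>))"
  fix m n
  have g: "norm (pochhammer a k * pochhammer a' k) \<le> ((1 + norm a) * (1 + norm a')) ^ k * (fact k)\<^sup>2" for a a' :: complex and k
    using mult_mono[OF norm_pochhammer_le[of a k] norm_pochhammer_le[of a' k]]
    by (simp add: norm_mult power_mult_distrib power2_eq_square mult_ac)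
  have c: "(1 / norm (pochhammer (1 - Z) (m + n))) \<le> K ^ (m + n) / fact (m + n)"
  proof (cases "pochhammer (1 - Z) (m + n) = 0")
    case True
    then show ?thesis using \<open>K > 0\<close> by simp
  next
    case False
    then show ?thesis using K[of "m + n"] by (simp add: field_simps)
  qed
  have f: "fact m * fact n \<le> (fact (m + n) :: real)"
    by (metis dvd_imp_le fact_fact_dvd_fact fact_gt_zero of_nat_fact of_nat_le_iff of_nat_mult)
  have "norm (appell_F3_term \<alpha> \<beta> Z x y (m, n)) =
     norm (pochhammer (1/2 - \<alpha>) m * pochhammer (1/2 + \<alpha>) m) * norm (pochhammer (1/2 - \<beta>) n * pochhammer (1/2 + \<beta>) n)
     * (1 / norm (pochhammer (1 - Z) (m + n))) * (norm x ^ m * norm y ^ n / (fact m * fact n))"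
    by (simp add: appell_F3_term_def norm_mult norm_divide norm_power mult_ac)
  also have "\<dots> \<le> (?A ^ m * (fact m)\<^sup>2) * (?B ^ n * (fact n)\<^sup>2) * (K ^ (m + n) / fact (m + n)) *
      (norm x ^ m * norm y ^ n / (fact m * fact n))"
    using \<open>K > 0\<close> by (intro mult_mono g c) auto
  also have "\<dots> = (?A * K * norm x) ^ m * (?B * K * norm y) ^ n * (fact m * fact n / fact (m + n))"
    by (simp add: power_mult_distrib power_add power2_eq_square)
  also have "\<dots> \<le> (?A * K * norm x) ^ m * (?B * K * norm y) ^ n * 1"
    using f \<open>K > 0\<close> by (intro mult_left_mono) auto
  finally show "norm (appell_F3_term \<alpha> \<beta> Z x y (m, n)) \<le> (?A * K * norm x) ^ m * (?B * K * norm y) ^ n"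
    by simp
qed (use assms in auto)

text \<open>
  Here the factorials combine to the binomial coefficient \<open>(m + 2 * n) choose n\<close>, which is at most \<open>2 ^ (m + 2 * n)\<close>;
  the denominators 4 in \<open>z / 4\<close> absorb this power of 2.
\<close>

lemma shifted_series_summable:
  fixes b N z :: complex
  assumes "K > 0" and K: "\<And>n. fact n \<le> K ^ n * norm (pochhammer c n)"
    and p: "(1 + norm b) * (1 + norm (1 - b)) * K * norm z < 1"
    and q: "(1 + norm N)\<^sup>2 * K * norm z < 1"
  shows "(\<lambda>(\<nu>, k). pochhammer b \<nu> * pochhammer (1 - b) \<nu> * pochhammer (N + of_nat \<nu>) (2 * k)
        / (pochhammer c (\<nu> + k) * fact \<nu> * fact k) * (z / 4) ^ (\<nu> + k)) summable_on UNIV"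
proof (rule summable_on_geometric_bound, unfold prod.case)
  let ?B = "(1 + norm b) * (1 + norm (1 - b))"
  let ?L = "1 + norm N"
  fix m n
  have four: "(2 ^ (2 * k) :: real) = 4 ^ k" for k
    by (simp add: power_mult)
  have powers: "B ^ m * L ^ n * K ^ (m + n) * (t / 4) ^ (m + n) * (2 ^ m * 4 ^ n) = (B * K * t) ^ m * (L * K * t) ^ n * (2 ^ m / 4 ^ m)"
    for B L t :: real
    by (simp add: power_add power_mult_distrib power_divide)
  have g: "norm (pochhammer b m * pochhammer (1 - b) m) \<le> ?B ^ m * (fact m)\<^sup>2"
    using mult_mono[OF norm_pochhammer_le[of b m] norm_pochhammer_le[of "1 - b" m]]
    by (simp add: norm_mult power_mult_distrib power2_eq_square mult_ac)
  have h: "norm (pochhammer (N + of_nat m) (2 * n)) \<le> ?L ^ (2 * n) * fact (m + 2 * n) / fact m"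
    using norm_pochhammer_shifted_le[of N m "2 * n"] by (simp add: field_simps)
  have c: "(1 / norm (pochhammer c (m + n))) \<le> K ^ (m + n) / fact (m + n)"
  proof (cases "pochhammer c (m + n) = 0")
    case True
    then show ?thesis using \<open>K > 0\<close> by simp
  next
    case False
    then show ?thesis using K[of "m + n"] by (simp add: field_simps)
  qed
  have f: "fact (m + 2 * n) / (fact (m + n) * fact n) \<le> (2 :: real) ^ (m + 2 * n)"
  proof -
    have diff_eq: "m + 2 * n - n = m + n" by simp
    have "fact (m + 2 * n) / (fact (m + n) * fact n) = real ((m + 2 * n) choose n)"
      using binomial_fact[of n "m + 2 * n", where ?'a = real] diff_eq by (simp add: mult.commute add.commute)
    also have "\<dots> \<le> real (2 ^ (m + 2 * n))"
      by (intro of_nat_mono binomial_le_pow2)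
    finally show ?thesis by simp
  qed
  have "norm (pochhammer b m * pochhammer (1 - b) m * pochhammer (N + of_nat m) (2 * n)
        / (pochhammer c (m + n) * fact m * fact n) * (z / 4) ^ (m + n)) =
     norm (pochhammer b m * pochhammer (1 - b) m) * norm (pochhammer (N + of_nat m) (2 * n))
     * (1 / norm (pochhammer c (m + n))) * ((norm z / 4) ^ (m + n) / (fact m * fact n))"
    by (simp add: norm_mult norm_divide norm_power mult_ac)
  also have "\<dots> \<le> (?B ^ m * (fact m)\<^sup>2) * (?L ^ (2 * n) * fact (m + 2 * n) / fact m) * (K ^ (m + n) / fact (m + n)) *
      ((norm z / 4) ^ (m + n) / (fact m * fact n))"
    using \<open>K > 0\<close> by (intro mult_mono g h c) auto
  also have "\<dots> = (?B ^ m * ?L ^ (2 * n) * K ^ (m + n) * (norm z / 4) ^ (m + n)) * (fact (m + 2 * n) / (fact (m + n) * fact n))"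
    by (simp add: power2_eq_square)
  also have "\<dots> \<le> (?B ^ m * ?L ^ (2 * n) * K ^ (m + n) * (norm z / 4) ^ (m + n)) * 2 ^ (m + 2 * n)"
    using \<open>K > 0\<close> by (intro mult_left_mono f) auto
  also have "\<dots> = (?B * K * norm z) ^ m * (?L\<^sup>2 * K * norm z) ^ n * (2 ^ m / 4 ^ m)"
    unfolding power_mult[of ?L 2] power_add[of 2 m] four by (rule powers)
  also have "\<dots> \<le> (?B * K * norm z) ^ m * (?L\<^sup>2 * K * norm z) ^ n * 1"
    using \<open>K > 0\<close> by (intro mult_left_mono) (auto intro!: power_mono simp: divide_le_eq)
  finally show "norm (pochhammer b m * pochhammer (1 - b) m * pochhammer (N + of_nat m) (2 * n)
        / (pochhammer c (m + n) * fact m * fact n) * (z / 4) ^ (m + n)) \<le> (?B * K * norm z) ^ m * (?L\<^sup>2 * K * norm z) ^ n"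
    by simp
qed (use assms in auto)

lemma curve_point_bound:
  fixes x :: complex
  assumes "norm x < 1/10"
  shows "norm (x / (2 * x - 1)) \<le> 2 * norm x"
proof -
  have "norm (2 * x - 1) \<ge> 1 - 2 * norm x"
    using norm_triangle_ineq3[of "2 * x" 1] by (simp add: norm_mult)
  then have 1: "norm (2 * x - 1) \<ge> 1/2" using assms by simp
  have "norm x / norm (2 * x - 1) \<le> norm x / (1/2)"
    using 1 by (intro frac_le) auto
  then show ?thesis by (simp add: norm_divide)
qed

text \<open>
  The heart of the argument, as outlined at the beginning, at a single point where the two double series
  involved converge.
\<close>

lemma appell_F3_on_curve:
  fixes \<alpha> \<beta> Z c b1 b2 :: complex
  assumes c_def: "c = 1 - Z" and b1_def: "b1 = 1/2 + \<alpha>" and b2_def: "b2 = 1/2 + \<beta>"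
    and generic: "c \<notin> \<int>\<^sub>\<le>\<^sub>0" and x: "norm x < 1/10"
    and sum1: "appell_F3_term \<alpha> \<beta> Z x (x / (2 * x - 1)) summable_on UNIV"
    and z_def: "z = - 4 * x * (1 - x) / (1 - 2 * x)\<^sup>2"
    and sum2: "(\<lambda>(\<nu>, k). pochhammer b2 \<nu> * pochhammer (1 - b2) \<nu> * pochhammer (c - b1 + of_nat \<nu>) (2 * k)
        / (pochhammer c (\<nu> + k) * fact \<nu> * fact k) * (z / 4) ^ (\<nu> + k)) summable_on UNIV"
  shows "appell_F3 \<alpha> \<beta> Z x (x / (2 * x - 1)) =
         (1 - x) powr (c - 1) * (1 - 2 * x) powr b2 *
         hyp2F1 ((b2 - b1 + c) / 2) ((b1 + b2 + c - 1) / 2) c (4 * x * (1 - x))"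
proof -
  define N where "N = c - b1"
  define y where "y = x / (2 * x - 1)"
  define U where "U = (1 - x) powr (c - 1) * (1 - 2 * x) powr (- N)"
  define S where "S = appell_F3 \<alpha> \<beta> Z x y"
  note nz = quadratic_argument_bound(1,2)[OF x]
  have x1: "norm x < 1" using x by simp
  have z1: "norm z < 1"
    using quadratic_argument_bound(3)[OF x] x by (simp add: z_def)
  have half: "1/2 - \<alpha> = 1 - b1" "1/2 + \<alpha> = b1" "1/2 - \<beta> = 1 - b2" "1/2 + \<beta> = b2" "1 - Z = c"
    by (simp_all add: c_def b1_def b2_def)
  have S: "(appell_F3_term \<alpha> \<beta> Z x y has_sum S) (UNIV \<times> UNIV)"
    using sum1 by (simp add: S_def appell_F3_def y_def)
  \<comment> \<open>The relation that singles out the curve: the power series in \<open>y\<close> becomes one in \<open>z\<close>.\<close>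
  have yz: "y * ((1 - x) / (1 - 2 * x)) = z / 4"
  proof -
    have "2 * x - 1 = - (1 - 2 * x)" by simp
    then have "y = - x / (1 - 2 * x)" unfolding y_def by (metis divide_minus_right minus_divide_left)
    then show ?thesis using nz by (simp add: z_def power2_eq_square)
  qed
  have row: "((\<lambda>\<mu>. appell_F3_term \<alpha> \<beta> Z x y (\<mu>, \<nu>)) has_sum
     (pochhammer b2 \<nu> * pochhammer (1 - b2) \<nu> / (pochhammer c \<nu> * fact \<nu>) * y ^ \<nu> *
      hyp2F1 b1 (1 - b1) (c + of_nat \<nu>) x)) UNIV" for \<nu>
  proof -
    have "appell_F3_term \<alpha> \<beta> Z x y (\<mu>, \<nu>) = pochhammer b2 \<nu> * pochhammer (1 - b2) \<nu> / (pochhammer c \<nu> * fact \<nu>) * y ^ \<nu> *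
      (pochhammer b1 \<mu> * pochhammer (1 - b1) \<mu> / (pochhammer (c + of_nat \<nu>) \<mu> * fact \<mu>) * x ^ \<mu>)" for \<mu>
      by (simp add: appell_F3_term_def half add.commute[of \<mu> \<nu>] pochhammer_product'[of c \<nu> \<mu>] mult_ac)
    then show ?thesis
      by (simp only:) (intro has_sum_cmult_right has_sum_hyp2F1 not_nonpos_Int_shift generic x1)
  qed
  have "((\<lambda>\<nu>. pochhammer b2 \<nu> * pochhammer (1 - b2) \<nu> / (pochhammer c \<nu> * fact \<nu>) * y ^ \<nu> *
      hyp2F1 b1 (1 - b1) (c + of_nat \<nu>) x) has_sum S) UNIV"
    by (rule has_sum_SigmaD[OF S[unfolded has_sum_swap[of "appell_F3_term \<alpha> \<beta> Z x y"]]])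
      (simp only: prod.case, rule row)
  also have "(\<lambda>\<nu>. pochhammer b2 \<nu> * pochhammer (1 - b2) \<nu> / (pochhammer c \<nu> * fact \<nu>) * y ^ \<nu> *
      hyp2F1 b1 (1 - b1) (c + of_nat \<nu>) x) = (\<lambda>\<nu>. U *
     (pochhammer b2 \<nu> * pochhammer (1 - b2) \<nu> / (pochhammer c \<nu> * fact \<nu>) * (z / 4) ^ \<nu> *
      hyp2F1 ((N + of_nat \<nu>) / 2) ((N + of_nat \<nu> + 1) / 2) (c + of_nat \<nu>) z))"
  proof
    fix \<nu>
    have "(1 - x) powr (c + of_nat \<nu> - 1) = (1 - x) powr (c - 1) * (1 - x) ^ \<nu>"
      using nz by (simp add: powr_nat' add_diff_eq[symmetric] add.commute[of c] powr_add[of _ "of_nat \<nu>" "c - 1"] mult.commute)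
    moreover have "(1 - 2 * x) powr (- (N + of_nat \<nu>)) = (1 - 2 * x) powr (- N) / (1 - 2 * x) ^ \<nu>"
      using nz by (simp add: powr_diff powr_nat')
    ultimately have q: "hyp2F1 b1 (1 - b1) (c + of_nat \<nu>) x = U * ((1 - x) / (1 - 2 * x)) ^ \<nu> *
       hyp2F1 ((N + of_nat \<nu>) / 2) ((N + of_nat \<nu> + 1) / 2) (c + of_nat \<nu>) z"
      using quadratic_transformation[OF not_nonpos_Int_shift[OF generic, of \<nu>] x, of "N + of_nat \<nu>" b1]
      by (simp add: N_def U_def z_def power_divide)
    show "pochhammer b2 \<nu> * pochhammer (1 - b2) \<nu> / (pochhammer c \<nu> * fact \<nu>) * y ^ \<nu> *
      hyp2F1 b1 (1 - b1) (c + of_nat \<nu>) x = U *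
     (pochhammer b2 \<nu> * pochhammer (1 - b2) \<nu> / (pochhammer c \<nu> * fact \<nu>) * (z / 4) ^ \<nu> *
      hyp2F1 ((N + of_nat \<nu>) / 2) ((N + of_nat \<nu> + 1) / 2) (c + of_nat \<nu>) z)"
      unfolding q yz[symmetric] power_mult_distrib by (simp only: mult_ac)
  qed
  finally have "S = U * hyp2F1 ((N + b2) / 2) ((N + 1 - b2) / 2) c z"
    using has_sum_cmult_right[OF shifted_series_regrouped[OF generic z1 sum2[folded N_def]], of U] 
    by (rule has_sum_unique)
  moreover have "hyp2F1 ((b2 - b1 + c) / 2) ((b1 + b2 + c - 1) / 2) c (4 * x * (1 - x)) =
     (1 - 2 * x) powr (- (N + b2)) * hyp2F1 ((N + b2) / 2) ((N + 1 - b2) / 2) c z"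
  proof -
    define w where "w = 4 * x * (1 - x)"
    \<comment> \<open>Since \<open>1 - w\<close> is the square of a number with positive real part, its principal powers are those of \<open>1 - 2 * x\<close> with doubled exponent.\<close>
    have w: "1 - w = (1 - 2 * x)\<^sup>2" by (simp add: w_def power2_eq_square algebra_simps)
    have "norm w \<le> 4 * norm x * (1 + norm x)"
      using norm_triangle_ineq4[of 1 x] by (auto simp: w_def norm_mult intro: mult_left_mono)
    also have "\<dots> \<le> 4 * (1/10) * (1 + 1/10)"
      using x by (intro mult_mono) auto
    finally have "norm w < 1/2" by simp
    note pfaff = pfaff_transformation[OF generic this, of "(N + b2) / 2" "(b1 + b2 + c - 1) / 2"]
    have c': "c - (b1 + b2 + c - 1) / 2 = (N + 1 - b2) / 2" by (simp add: N_def field_simps)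
    have "w - 1 = - ((1 - 2 * x)\<^sup>2)" using w by (simp add: algebra_simps)
    then have z': "w / (w - 1) = z" by (simp add: w_def z_def)
    have pow: "(1 - w) powr (- ((N + b2) / 2)) = (1 - 2 * x) powr (- (N + b2))"
    proof -
      have re: "Re (1 - 2 * x) > 0" using x complex_Re_le_cmod[of x] by simp
      then have "Arg (1 - 2 * x) \<in> {-pi/2<..<pi/2}"
        using Arg_Re_pos[of "1 - 2 * x"] by auto
      then have "Ln ((1 - 2 * x) ^ 2) = of_nat 2 * Ln (1 - 2 * x)"
        using nz Arg_eq_Im_Ln[of "1 - 2 * x"] by (intro Ln_unique) (auto simp: exp_double exp_Ln)
      then have Ln: "Ln ((1 - 2 * x) ^ 2) = 2 * Ln (1 - 2 * x)" by simp
      have "- ((N + b2) / 2) * (2 * l) = - (N + b2) * l" for l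
        by (simp add: algebra_simps)
      then show ?thesis using nz unfolding w by (simp only: powr_def Ln) (simp only: power_eq_0_iff, simp)
    qed
    have "b2 - b1 + c = N + b2" by (simp add: N_def)
    then have N': "(b2 - b1 + c) / 2 = (N + b2) / 2" by (rule arg_cong)
    show ?thesis
      unfolding N' using pfaff unfolding c' z' pow unfolding w_def .
  qed
  moreover have "(1 - 2 * x) powr (- N) = (1 - 2 * x) powr b2 * (1 - 2 * x) powr (- (N + b2))"
    unfolding powr_add[symmetric] by simp
  ultimately show ?thesis by (simp add: S_def U_def y_def mult_ac)
qed

text \<open>
  It remains to choose the radius: \<open>M\<close> majorises the three growth constants of the convergence criteria, and the
  points \<open>y\<close> and \<open>z\<close> belonging to \<open>x\<close> have norm at most \<open>7 * norm x\<close>.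
\<close>

lemma appell_F3_reduction:
  fixes \<alpha> \<beta> Z c b1 b2 :: complex
  assumes c_def: "c = 1 - Z" and b1_def: "b1 = 1/2 + \<alpha>" and b2_def: "b2 = 1/2 + \<beta>"
    and generic: "c \<notin> \<int>\<^sub>\<le>\<^sub>0"
  obtains r where "0 < r" "r \<le> 1/10" "\<And>x. norm x < r \<Longrightarrow> appell_F3_term \<alpha> \<beta> Z x (x / (2 * x - 1)) summable_on UNIV"
    "\<And>x. norm x < r \<Longrightarrow> appell_F3 \<alpha> \<beta> Z x (x / (2 * x - 1)) =
         (1 - x) powr (c - 1) * (1 - 2 * x) powr b2 *
         hyp2F1 ((b2 - b1 + c) / 2) ((b1 + b2 + c - 1) / 2) c (4 * x * (1 - x))"
proof -
  obtain K where K: "K > 0" "\<And>n. fact n \<le> K ^ n * norm (pochhammer c n)"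
    using norm_pochhammer_ge[OF generic] by blast
  define M where "M = (1 + norm b1) * (1 + norm (1 - b1)) + (1 + norm b2) * (1 + norm (1 - b2)) + (1 + norm (c - b1))\<^sup>2"
  define r where "r = 1 / (10 * (1 + M * K))"
  have M: "M \<ge> 0" by (simp add: M_def)
  have r: "0 < r" "r \<le> 1/10"
    using M K by (auto simp: r_def field_simps add_pos_nonneg)
  have small: "C * K * norm v < 1" if "0 \<le> C" "C \<le> M" "norm v \<le> 7 * norm x" "norm x < r" for C and v x :: complex
  proof -
    have "norm v \<le> 7 * r" using that by simp
    then have "C * K * norm v \<le> M * K * (7 * r)"
      using that K M by (intro mult_mono) auto
    also have "\<dots> < 1"
      using M K by (simp add: r_def field_simps add_pos_nonneg)
    finally show ?thesis .
  qed
  have x10: "norm x < 1/10" if "norm x < r" for x :: complex using that r by simp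
  have halves: "1/2 - \<alpha> = 1 - b1" "1/2 + \<alpha> = b1" "1/2 - \<beta> = 1 - b2" "1/2 + \<beta> = b2"
    by (simp_all add: b1_def b2_def)
  have C: "(1 + norm b1) * (1 + norm (1 - b1)) \<le> M" "(1 + norm b2) * (1 + norm (1 - b2)) \<le> M" "(1 + norm (c - b1))\<^sup>2 \<le> M"
    by (auto simp: M_def)
  have sum1: "appell_F3_term \<alpha> \<beta> Z x (x / (2 * x - 1)) summable_on UNIV" if "norm x < r" for x
  proof (rule appell_F3_term_summable[OF K(1)])
    show "fact n \<le> K ^ n * norm (pochhammer (1 - Z) n)" for n using K(2) by (simp add: c_def)
    show "(1 + norm (1/2 - \<alpha>)) * (1 + norm (1/2 + \<alpha>)) * K * norm x < 1"
      unfolding halves using small[OF _ C(1), of x x] that by (simp add: mult_ac)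
    show "(1 + norm (1/2 - \<beta>)) * (1 + norm (1/2 + \<beta>)) * K * norm (x / (2 * x - 1)) < 1"
    proof -
      have "norm (x / (2 * x - 1)) \<le> 7 * norm x"
        using curve_point_bound[OF x10[OF that]] norm_ge_zero[of x] by linarith
      then have "((1 + norm b2) * (1 + norm (1 - b2))) * K * norm (x / (2 * x - 1)) < 1"
        using that by (intro small C) auto
      then show ?thesis
        unfolding halves by (simp add: mult_ac)
    qed
  qed
  have sum2: "(\<lambda>(\<nu>, k). pochhammer b2 \<nu> * pochhammer (1 - b2) \<nu> * pochhammer (c - b1 + of_nat \<nu>) (2 * k)
        / (pochhammer c (\<nu> + k) * fact \<nu> * fact k) * (- 4 * x * (1 - x) / (1 - 2 * x)\<^sup>2 / 4) ^ (\<nu> + k)) summable_on UNIV"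
    if "norm x < r" for x
    using quadratic_argument_bound(3)[OF x10[OF that]] that
    by (intro shifted_series_summable[OF K] small C) auto
  show thesis
    using appell_F3_on_curve[OF assms x10 sum1 refl sum2] by (intro that[OF r sum1])
qed

section \<open>Continuation along paths\<close>

text \<open>
  Turns an eventual property into the shape of neighbourhood required by induction over connected sets.
\<close>

lemma eventually_within_openin:
  assumes "\<forall>\<^sub>F s in at a within S. Q s" "Q a" "a \<in> S"
  obtains T where "openin (top_of_set S) T" "a \<in> T" "\<And>s. s \<in> T \<Longrightarrow> Q s"
proof -
  obtain U where "open U" "a \<in> U" "\<And>s. s \<in> U \<Longrightarrow> s \<noteq> a \<Longrightarrow> s \<in> S \<Longrightarrow> Q s"
    using assms(1) unfolding eventually_at_topological by blast
  with assms show thesis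
    by (intro that[of "S \<inter> U"]) auto
qed

lemma path_within: "path \<gamma> \<Longrightarrow> t \<in> {0..1} \<Longrightarrow> (\<gamma> \<longlongrightarrow> \<gamma> t) (at t within {0..1})"
  unfolding path_def continuous_on_def by blast

text \<open>
  Agreement of the two germs is an open and closed condition on the parameter: near \<open>a\<close> all germs come from
  \<open>\<Phi> a\<close> and \<open>\<Psi> a\<close>, which are holomorphic on a common disc and hence agree on all of it as soon as they agree
  near one of its points.
\<close>

lemma continuation_unique:
  assumes F: "continuation_along analytic1_at \<gamma> f \<Phi>" and G: "continuation_along analytic1_at \<gamma> g \<Psi>"
    and start: "\<forall>\<^sub>F z in nhds (\<gamma> 0). f z = g z" and "t \<in> {0..1}"
  shows "\<forall>\<^sub>F z in nhds (\<gamma> t). \<Phi> t z = \<Psi> t z"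
proof (rule connected_induction_simple[where S = "{0..1::real}" and a = 0])
  show "\<forall>\<^sub>F z in nhds (\<gamma> 0). \<Phi> 0 z = \<Psi> 0 z"
    using F G start unfolding continuation_along_def by (auto elim: eventually_elim2 elim!: eventually_rev_mp)
next
  fix a :: real assume a: "a \<in> {0..1}"
  have "\<Phi> a analytic_on {\<gamma> a}" "\<Psi> a analytic_on {\<gamma> a}"
    using F G a by (auto simp: continuation_along_def analytic1_at_def)
  then obtain R1 R2 where R: "R1 > 0" "\<Phi> a holomorphic_on ball (\<gamma> a) R1" "R2 > 0" "\<Psi> a holomorphic_on ball (\<gamma> a) R2"
    unfolding analytic_on_def by blast
  define B where "B = ball (\<gamma> a) (min R1 R2)"
  have hol: "\<Phi> a holomorphic_on B" "\<Psi> a holomorphic_on B"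
    using R unfolding B_def by (auto elim!: holomorphic_on_subset)
  have B: "open B" "\<gamma> a \<in> B" "connected B" using R by (auto simp: B_def)
  have "\<forall>\<^sub>F s in at a within {0..1}. \<gamma> s \<in> B"
    using F a B by (intro topological_tendstoD[OF path_within]) (auto simp: continuation_along_def)
  moreover have "\<forall>\<^sub>F s in at a within {0..1}. \<forall>\<^sub>F z in nhds (\<gamma> s). \<Phi> s z = \<Phi> a z"
    "\<forall>\<^sub>F s in at a within {0..1}. \<forall>\<^sub>F z in nhds (\<gamma> s). \<Psi> s z = \<Psi> a z"
    using F G a by (auto simp: continuation_along_def)
  ultimately have "\<forall>\<^sub>F s in at a within {0..1}. \<gamma> s \<in> B \<and> (\<forall>\<^sub>F z in nhds (\<gamma> s). \<Phi> s z = \<Phi> a z) \<and>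
      (\<forall>\<^sub>F z in nhds (\<gamma> s). \<Psi> s z = \<Psi> a z)"
    by eventually_elim auto
  then obtain T where T: "openin (top_of_set {0..1}) T" "a \<in> T"
    "\<And>s. s \<in> T \<Longrightarrow> \<gamma> s \<in> B \<and> (\<forall>\<^sub>F z in nhds (\<gamma> s). \<Phi> s z = \<Phi> a z) \<and> (\<forall>\<^sub>F z in nhds (\<gamma> s). \<Psi> s z = \<Psi> a z)"
    by (rule eventually_within_openin) (use a B in auto)
  have "\<forall>\<^sub>F z in nhds (\<gamma> y). \<Phi> y z = \<Psi> y z" if "x \<in> T" "y \<in> T" "\<forall>\<^sub>F z in nhds (\<gamma> x). \<Phi> x z = \<Psi> x z" for x y
  proof -
    have "\<forall>\<^sub>F z in nhds (\<gamma> x). z \<in> B"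
      using T(3)[OF that(1)] B by (intro eventually_nhds_in_open) auto
    moreover have "\<forall>\<^sub>F z in nhds (\<gamma> x). \<Phi> x z = \<Phi> a z" "\<forall>\<^sub>F z in nhds (\<gamma> x). \<Psi> x z = \<Psi> a z"
      using T(3)[OF that(1)] by auto
    ultimately have "\<forall>\<^sub>F z in nhds (\<gamma> x). z \<in> B \<and> \<Phi> a z = \<Psi> a z"
      using that(3) by eventually_elim auto
    then obtain W where W: "open W" "\<gamma> x \<in> W" "\<And>z. z \<in> W \<Longrightarrow> z \<in> B \<and> \<Phi> a z = \<Psi> a z"
      unfolding eventually_nhds by blast
    have eq: "\<Phi> a z = \<Psi> a z" if "z \<in> B" for z
      by (rule analytic_continuation_open[of W B "\<Phi> a" "\<Psi> a"]) (use W B hol that in auto)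
    have "\<forall>\<^sub>F z in nhds (\<gamma> y). z \<in> B"
      using T(3)[OF that(2)] B by (intro eventually_nhds_in_open) auto
    moreover have "\<forall>\<^sub>F z in nhds (\<gamma> y). \<Phi> y z = \<Phi> a z" "\<forall>\<^sub>F z in nhds (\<gamma> y). \<Psi> y z = \<Psi> a z"
      using T(3)[OF that(2)] by auto
    ultimately show ?thesis
      by eventually_elim (use eq in auto)
  qed
  with T show "\<exists>T. openin (top_of_set {0..1}) T \<and> a \<in> T \<and> (\<forall>x\<in>T. \<forall>y\<in>T.
      (\<forall>\<^sub>F z in nhds (\<gamma> x). \<Phi> x z = \<Psi> x z) \<longrightarrow> (\<forall>\<^sub>F z in nhds (\<gamma> y). \<Phi> y z = \<Psi> y z))"
    by blast
qed (use assms in auto)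

lemma continuation_cong:
  assumes "continuation_along A \<gamma> f \<Phi>" "\<forall>\<^sub>F z in nhds (\<gamma> 0). f z = g z"
  shows "continuation_along A \<gamma> g \<Phi>"
  using assms unfolding continuation_along_def by (auto elim: eventually_elim2)

lemma continuation_mult:
  assumes F: "continuation_along analytic1_at \<gamma> f \<Phi>" and G: "continuation_along analytic1_at \<gamma> g \<Psi>"
  shows "continuation_along analytic1_at \<gamma> (\<lambda>z. f z * g z) (\<lambda>t z. \<Phi> t z * \<Psi> t z)"
  unfolding continuation_along_def
proof (intro conjI ballI)
  show "path \<gamma>" using F by (simp add: continuation_along_def)
  show "\<forall>\<^sub>F z in nhds (\<gamma> 0). \<Phi> 0 z * \<Psi> 0 z = f z * g z"
    using F G unfolding continuation_along_def by (auto elim: eventually_elim2)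
  fix t :: real assume t: "t \<in> {0..1}"
  show "analytic1_at (\<lambda>z. \<Phi> t z * \<Psi> t z) (\<gamma> t)"
    using F G t by (auto simp: continuation_along_def analytic1_at_def intro: analytic_on_mult)
  have "\<forall>\<^sub>F s in at t within {0..1}. \<forall>\<^sub>F z in nhds (\<gamma> s). \<Phi> s z = \<Phi> t z"
    "\<forall>\<^sub>F s in at t within {0..1}. \<forall>\<^sub>F z in nhds (\<gamma> s). \<Psi> s z = \<Psi> t z"
    using F G t by (auto simp: continuation_along_def)
  then show "\<forall>\<^sub>F s in at t within {0..1}. \<forall>\<^sub>F z in nhds (\<gamma> s). \<Phi> s z * \<Psi> s z = \<Phi> t z * \<Psi> t z"
    by eventually_elim (auto elim: eventually_elim2)
qed

text \<open>
  Pulling back a continuation along \<open>h\<close>. The two notions of analyticity are kept abstract so that the lemma covers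
  substitutions in one variable as well as the passage from two variables to a curve.
\<close>

lemma continuation_compose:
  assumes F: "continuation_along A \<delta> f \<Phi>" and "path \<gamma>"
    and h: "\<And>t. t \<in> {0..1} \<Longrightarrow> \<delta> t = h (\<gamma> t)"
    and cont: "\<And>t. t \<in> {0..1} \<Longrightarrow> isCont h (\<gamma> t)"
    and analytic: "\<And>t \<phi>. t \<in> {0..1} \<Longrightarrow> A \<phi> (\<delta> t) \<Longrightarrow> A' (\<lambda>x. \<phi> (h x)) (\<gamma> t)"
  shows "continuation_along A' \<gamma> (\<lambda>x. f (h x)) (\<lambda>t x. \<Phi> t (h x))"
proof -
  have pull: "\<forall>\<^sub>F x in nhds (\<gamma> t). Q (h x)" if "t \<in> {0..1}" "\<forall>\<^sub>F z in nhds (\<delta> t). Q z" for t Q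
    using that cont[OF that(1)] h[OF that(1)]
    by (intro eventually_compose_filterlim[OF that(2)]) (simp add: isCont_def tendsto_at_iff_tendsto_nhds)
  show ?thesis
    unfolding continuation_along_def
  proof (intro conjI ballI)
    show "\<forall>\<^sub>F x in nhds (\<gamma> 0). \<Phi> 0 (h x) = f (h x)"
      using F by (intro pull) (auto simp: continuation_along_def)
    fix t :: real assume t: "t \<in> {0..1}"
    show "A' (\<lambda>x. \<Phi> t (h x)) (\<gamma> t)"
      using F t by (intro analytic) (auto simp: continuation_along_def)
    have "\<forall>\<^sub>F s in at t within {0..1}. \<forall>\<^sub>F z in nhds (\<delta> s). \<Phi> s z = \<Phi> t z"
      using F t by (auto simp: continuation_along_def)
    moreover have "\<forall>\<^sub>F s in at t within {0..1}. s \<in> {0..1}"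
      by (simp add: eventually_at_topological) blast
    ultimately show "\<forall>\<^sub>F s in at t within {0..1}. \<forall>\<^sub>F x in nhds (\<gamma> s). \<Phi> s (h x) = \<Phi> t (h x)"
      by eventually_elim (rule pull)
  qed fact
qed

text \<open>
  A germ continues along a path if germs of a suitable kind (\<open>good\<close>, for instance the solutions of a
  differential equation) extend over discs around the points of the path, uniformly for all base points in the disc.
  The initial segment up to \<open>a\<close> is treated separately, since the path may start at a point
  without this extension property, such as the singular point 0 of Gauss's equation.
\<close>

lemma continuation_exists:
  fixes good :: "(complex \<Rightarrow> complex) \<Rightarrow> complex \<Rightarrow> bool"
  assumes path: "path \<gamma>" and a: "0 \<le> a" "a \<le> 1"
    and initial: "\<And>t. t \<in> {0..a} \<Longrightarrow> f analytic_on {\<gamma> t}"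
    and good_a: "good f (\<gamma> a)"
    and good_analytic: "\<And>g q. good g q \<Longrightarrow> g analytic_on {q}"
    and extend: "\<And>t. t \<in> {a..1} \<Longrightarrow> \<exists>R>0. \<forall>q\<in>ball (\<gamma> t) R. \<forall>g. good g q \<longrightarrow>
        (\<exists>h. (\<forall>q'\<in>ball (\<gamma> t) R. good h q') \<and> (\<forall>\<^sub>F x in nhds q. h x = g x))"
  shows "\<exists>\<Phi>. continuation_along analytic1_at \<gamma> f \<Phi>"
proof -
  \<comment> \<open>A continuation over \<open>{0..t}\<close>; its germs are good from \<open>a\<close> on, so that it can be prolonged.\<close>
  define partial where "partial t \<Phi> \<longleftrightarrow>
      (\<forall>s\<in>{0..t}. \<Phi> s analytic_on {\<gamma> s}) \<and> (\<forall>s\<in>{a..t}. good (\<Phi> s) (\<gamma> s)) \<and>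
      (\<forall>s\<in>{0..t}. \<forall>\<^sub>F s' in at s within {0..t}. \<forall>\<^sub>F z in nhds (\<gamma> s'). \<Phi> s' z = \<Phi> s z) \<and>
      (\<forall>\<^sub>F z in nhds (\<gamma> 0). \<Phi> 0 z = f z)" for t \<Phi>
  have "\<exists>\<Phi>. partial 1 \<Phi>"
  proof (rule connected_induction_simple[where S = "{a..1}" and a = a and P = "\<lambda>t. \<exists>\<Phi>. partial t \<Phi>"])
    show "\<exists>\<Phi>. partial a \<Phi>"
      using initial good_a by (intro exI[of _ "\<lambda>_. f"]) (simp add: partial_def)
  next
    fix t assume t: "t \<in> {a..1}"
    obtain R where R: "R > 0" and ext: "\<And>q g. q \<in> ball (\<gamma> t) R \<Longrightarrow> good g q \<Longrightarrow>
        \<exists>h. (\<forall>q'\<in>ball (\<gamma> t) R. good h q') \<and> (\<forall>\<^sub>F x in nhds q. h x = g x)"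
      using extend[OF t] by blast
    have t01: "t \<in> {0..1}" using t a by auto
    have "\<forall>\<^sub>F s in at t within {0..1}. \<gamma> s \<in> ball (\<gamma> t) R"
      using R by (intro topological_tendstoD[OF path_within[OF path t01]]) auto
    then obtain d where d: "d > 0" "\<And>s. s \<in> {0..1} \<Longrightarrow> s \<noteq> t \<Longrightarrow> dist s t < d \<Longrightarrow> \<gamma> s \<in> ball (\<gamma> t) R"
      unfolding eventually_at by blast
    define T where "T = {a..1} \<inter> ball t d"
    have inB: "\<gamma> s \<in> ball (\<gamma> t) R" if "s \<in> {0..1}" "dist s t < d" for s
      using d(2)[OF that(1) _ that(2)] R by (cases "s = t") auto
    have "\<exists>\<Phi>. partial y \<Phi>" if x: "x \<in> T" and y: "y \<in> T" and \<Phi>: "partial x \<Phi>" for x y \<Phi>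
    proof (cases "y \<le> x")
      case True
      have mono: "at s within {0..y} \<le> at s within {0..x}" for s
        using True by (intro at_le) auto
      then have "partial y \<Phi>"
        using \<Phi> True unfolding partial_def by (auto intro!: filter_leD[OF mono])
      then show ?thesis by blast
    next
      case False
      have xy: "a \<le> x" "x < y" "y \<le> 1" "0 \<le> x" using False x y a by (auto simp: T_def)
      have dist: "dist s t < d" if "x \<le> s" "s \<le> y" for s
        using that x y by (auto simp: T_def dist_real_def abs_less_iff)
      have "good (\<Phi> x) (\<gamma> x)" using \<Phi> xy by (auto simp: partial_def)
      with ext[OF inB] obtain h where h: "\<And>q. q \<in> ball (\<gamma> t) R \<Longrightarrow> good h q"
        and hx: "\<forall>\<^sub>F z in nhds (\<gamma> x). h z = \<Phi> x z"
        using dist[of x] xy by (metis atLeastAtMost_iff less_imp_le order_refl order_trans)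
      \<comment> \<open>Prolong by a single function on \<open>{x<..y}\<close>; only the junction at \<open>x\<close> needs an argument.\<close>
      define \<Psi> where "\<Psi> s = (if s \<le> x then \<Phi> s else h)" for s
      have good_h: "good h (\<gamma> s)" if "x \<le> s" "s \<le> y" for s
        using that xy by (intro h inB dist) auto
      have un: "{0..y} = {0..x} \<union> {x..y}" using xy by auto
      have loc: "\<forall>\<^sub>F s' in at s within {0..y}. \<forall>\<^sub>F z in nhds (\<gamma> s'). \<Psi> s' z = \<Psi> s z" if s: "s \<in> {0..y}" for s
        unfolding un at_within_union eventually_sup
      proof
        have in1: "\<forall>\<^sub>F s' in at s within {0..x}. s' \<in> {0..x}"
          by (simp add: eventually_at_topological) blast
        have in2: "\<forall>\<^sub>F s' in at s within {x..y}. s' \<in> {x..y} \<and> s' \<noteq> s"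
          by (simp add: eventually_at_topological) blast
        show "\<forall>\<^sub>F s' in at s within {0..x}. \<forall>\<^sub>F z in nhds (\<gamma> s'). \<Psi> s' z = \<Psi> s z"
        proof (cases "s \<le> x")
          case True
          then have "\<forall>\<^sub>F s' in at s within {0..x}. \<forall>\<^sub>F z in nhds (\<gamma> s'). \<Phi> s' z = \<Phi> s z"
            using \<Phi> s by (auto simp: partial_def)
          with in1 show ?thesis
            by eventually_elim (use True in \<open>simp add: \<Psi>_def\<close>)
        next
          case False
          then have "\<forall>\<^sub>F s' in at s within {0..x}. s' > x"
            by (intro order_tendstoD(1)[OF tendsto_ident_at]) auto
          with in1 show ?thesis by eventually_elim auto
        qed
        consider "s < x" | "s = x" | "s > x" by linarith
        then show "\<forall>\<^sub>F s' in at s within {x..y}. \<forall>\<^sub>F z in nhds (\<gamma> s'). \<Psi> s' z = \<Psi> s z"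
        proof cases
          case 1
          then have "\<forall>\<^sub>F s' in at s within {x..y}. s' < x"
            by (intro order_tendstoD(2)[OF tendsto_ident_at]) auto
          with in2 show ?thesis by eventually_elim auto
        next
          case 2
          have "(\<gamma> \<longlongrightarrow> \<gamma> x) (at x within {x..y})"
            using xy by (intro tendsto_within_subset[OF path_within[OF path]]) auto
          moreover have "\<forall>\<^sub>F p in nhds (\<gamma> x). \<forall>\<^sub>F z in nhds p. h z = \<Phi> x z"
            using hx by (simp add: eventually_eventually)
          ultimately have "\<forall>\<^sub>F s' in at x within {x..y}. \<forall>\<^sub>F z in nhds (\<gamma> s'). h z = \<Phi> x z"
            by (rule eventually_compose_filterlim[rotated])
          with in2 show ?thesis unfolding 2
            by eventually_elim (simp add: \<Psi>_def)
        next
          case 3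
          then have "\<forall>\<^sub>F s' in at s within {x..y}. s' > x"
            by (intro order_tendstoD(1)[OF tendsto_ident_at]) auto
          then show ?thesis
            by eventually_elim (use 3 in \<open>simp add: \<Psi>_def\<close>)
        qed
      qed
      have "partial y \<Psi>"
        unfolding partial_def
      proof (intro conjI ballI loc)
        show "\<Psi> s analytic_on {\<gamma> s}" if "s \<in> {0..y}" for s
          using \<Phi> that good_analytic[OF good_h[of s]] by (auto simp: \<Psi>_def partial_def)
        show "good (\<Psi> s) (\<gamma> s)" if "s \<in> {a..y}" for s
          using \<Phi> that good_h[of s] by (auto simp: \<Psi>_def partial_def)
        show "\<forall>\<^sub>F z in nhds (\<gamma> 0). \<Psi> 0 z = f z"
          using \<Phi> xy by (simp add: \<Psi>_def partial_def)
      qed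
      then show ?thesis by blast
    qed
    moreover have "openin (top_of_set {a..1}) T" "t \<in> T"
      using t d by (auto simp: T_def)
    ultimately show "\<exists>T. openin (top_of_set {a..1}) T \<and> t \<in> T \<and>
        (\<forall>x\<in>T. \<forall>y\<in>T. (\<exists>\<Phi>. partial x \<Phi>) \<longrightarrow> (\<exists>\<Phi>. partial y \<Phi>))"
      by blast
  qed (use a in auto)
  then obtain \<Phi> where "partial 1 \<Phi>" ..
  then have "continuation_along analytic1_at \<gamma> f \<Phi>"
    using path by (auto simp: partial_def continuation_along_def analytic1_at_def)
  then show ?thesis by blast
qed

section \<open>Continuation of the Gauss function and of powers\<close>

lemma gauss_solution_subset: "gauss_solution a b c f S \<Longrightarrow> T \<subseteq> S \<Longrightarrow> gauss_solution a b c f T"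
  unfolding gauss_solution_def using holomorphic_on_subset by blast

lemma gauss_solution_diff:
  assumes "gauss_solution a b c f S" "gauss_solution a b c g S" "open S"
  shows "gauss_solution a b c (\<lambda>z. f z - g z) S"
proof (rule gauss_solutionI[OF \<open>open S\<close>, where g = "\<lambda>z. deriv f z - deriv g z"
      and h = "\<lambda>z. deriv (deriv f) z - deriv (deriv g) z"])
  fix z assume z: "z \<in> S"
  have hol: "f holomorphic_on S" "g holomorphic_on S" using assms by (auto simp: gauss_solution_def)
  then have hol': "deriv f holomorphic_on S" "deriv g holomorphic_on S" using \<open>open S\<close> by (auto intro: holomorphic_deriv)
  show "((\<lambda>z. f z - g z) has_field_derivative deriv f z - deriv g z) (at z)"
    "((\<lambda>z. deriv f z - deriv g z) has_field_derivative deriv (deriv f) z - deriv (deriv g) z) (at z)"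
    using hol hol' z \<open>open S\<close> by (auto intro!: derivative_intros holomorphic_derivI[where S = S])
  have "z * (1 - z) * deriv (deriv f) z + (c - (a + b + 1) * z) * deriv f z - a * b * f z = 0"
     "z * (1 - z) * deriv (deriv g) z + (c - (a + b + 1) * z) * deriv g z - a * b * g z = 0"
    using assms z by (auto simp: gauss_solution_def)
  then show "z * (1 - z) * (deriv (deriv f) z - deriv (deriv g) z) + (c - (a + b + 1) * z) * (deriv f z - deriv g z)
      - a * b * (f z - g z) = 0"
    by algebra
qed

text \<open>
  The solution with the Cauchy data of \<open>g\<close> at \<open>q\<close> converges on a disc of radius \<open>1 / K\<close> about \<open>q\<close>, with \<open>K\<close>
  independent of \<open>q\<close> near \<open>p\<close>; half of this radius about \<open>p\<close> fits into all these discs. Uniqueness for the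
  Cauchy problem identifies its germ at \<open>q\<close> with that of \<open>g\<close>.
\<close>

lemma gauss_solution_local_extension:
  assumes p: "p \<noteq> 0" "p \<noteq> 1"
  shows "\<exists>R>0. \<forall>q\<in>ball p R. \<forall>g. (\<exists>S. open S \<and> q \<in> S \<and> gauss_solution a b c g S) \<longrightarrow>
        (\<exists>h. gauss_solution a b c h (ball p R) \<and> (\<forall>\<^sub>F x in nhds q. h x = g x))"
proof -
  define K where "K = 2 + gauss_bound a b c p"
  have K: "K \<ge> 1" by (simp add: K_def gauss_bound_def)
  have "isCont (gauss_bound a b c) p"
    unfolding gauss_bound_def using p by (intro continuous_intros) auto
  then have "(gauss_bound a b c \<longlongrightarrow> gauss_bound a b c p) (nhds p)"
    by (simp add: isCont_def tendsto_at_iff_tendsto_nhds)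
  moreover have "gauss_bound a b c p < K" by (simp add: K_def)
  ultimately have "\<forall>\<^sub>F q in nhds p. gauss_bound a b c q < K"
    by (rule order_tendstoD)
  moreover have "\<forall>\<^sub>F q in nhds p. q \<in> - {0, 1}"
    using p by (intro eventually_nhds_in_open) auto
  ultimately have "\<forall>\<^sub>F q in nhds p. gauss_bound a b c q < K \<and> q \<noteq> 0 \<and> q \<noteq> 1"
    by eventually_elim auto
  then obtain e where e: "e > 0" "\<And>q. dist q p < e \<Longrightarrow> gauss_bound a b c q < K \<and> q \<noteq> 0 \<and> q \<noteq> 1"
    unfolding eventually_nhds_metric by blast
  define R where "R = min e (1 / (2 * K))"
  show ?thesis
  proof (intro exI[of _ R] conjI ballI allI impI)
    show "R > 0" using e K by (simp add: R_def)
    fix q g assume q: "q \<in> ball p R" and "\<exists>S. open S \<and> q \<in> S \<and> gauss_solution a b c g S"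
    then obtain S where S: "open S" "q \<in> S" "gauss_solution a b c g S" by blast
    have q': "gauss_bound a b c q < K" "q \<noteq> 0" "q \<noteq> 1"
      using e(2)[of q] q by (auto simp: R_def dist_commute)
    obtain h where h: "gauss_solution a b c h (ball q (1 / K))" "h q = g q" "deriv h q = deriv g q"
      using gauss_solution_exists[OF q'(2,3) K less_imp_le[OF q'(1)]] by blast
    have "R + R \<le> 1 / K" by (simp add: R_def)
    then have "ball p R \<subseteq> ball q (1 / K)"
    proof (intro subsetI)
      fix x assume "x \<in> ball p R"
      with q have "dist q x < R + R" using dist_triangle[of q x p] by (simp add: dist_commute)
      with \<open>R + R \<le> 1 / K\<close> show "x \<in> ball q (1 / K)" by simp
    qed
    then have "gauss_solution a b c h (ball p R)" using h(1) gauss_solution_subset by blast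
    moreover have "\<forall>\<^sub>F x in nhds q. h x = g x"
    proof -
      define T where "T = S \<inter> ball q (1 / K)"
      have T: "open T" "q \<in> T" using S K by (auto simp: T_def)
      have sol: "gauss_solution a b c h T" "gauss_solution a b c g T"
        using S(3) h(1) by (auto simp: T_def elim: gauss_solution_subset)
      have d: "deriv (\<lambda>z. h z - g z) q = 0"
        using sol h(3) T by (subst deriv_diff) (auto simp: gauss_solution_def intro: holomorphic_on_imp_differentiable_at)
      have "\<forall>\<^sub>F x in nhds q. h x - g x = 0"
        by (rule gauss_solution_zero[OF gauss_solution_diff[OF sol T(1)] T q'(2,3) _ d]) (simp add: h(2))
      then show ?thesis by simp
    qed
    ultimately show "\<exists>h. gauss_solution a b c h (ball p R) \<and> (\<forall>\<^sub>F x in nhds q. h x = g x)" by blast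
  qed
qed

text \<open>
  As long as the path stays in the unit disc, the Gauss series itself is the continuation; the starting
  point may be 0. Afterwards 0 and 1 are avoided and solutions of the differential equation extend locally.
\<close>

lemma hyp2F1_continuation_exists:
  assumes c: "c \<notin> \<int>\<^sub>\<le>\<^sub>0" and path: "path w" and w0: "norm (w 0) < 1" and avoid: "\<And>t. t \<in> {0<..1} \<Longrightarrow> w t \<noteq> 0 \<and> w t \<noteq> 1"
  shows "\<exists>H. continuation_along analytic1_at w (hyp2F1 a b c) H"
proof -
  define good where "good f q \<longleftrightarrow> (\<exists>S. open S \<and> q \<in> S \<and> gauss_solution a b c f S)" for f q
  have hyp: "gauss_solution a b c (hyp2F1 a b c) (ball 0 1)"
    by (rule gauss_solution_hyp2F1[OF c])
  have good_analytic: "g analytic_on {q}" if "good g q" for g q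
    using that analytic_at by (auto simp: good_def gauss_solution_def)
  have good_ball: "good (hyp2F1 a b c) q" if "norm q < 1" for q
    unfolding good_def using hyp that by (intro exI[of _ "ball 0 1"]) auto
  have "\<forall>\<^sub>F t in at 0 within {0..1}. w t \<in> ball 0 1"
    using w0 by (intro topological_tendstoD[OF path_within[OF path]]) auto
  then obtain d where d: "d > 0" "\<And>t. t \<in> {0..1} \<Longrightarrow> t \<noteq> 0 \<Longrightarrow> dist t 0 < d \<Longrightarrow> w t \<in> ball 0 1"
    unfolding eventually_at by blast
  define s where "s = min 1 (d / 2)"
  have s: "0 < s" "s \<le> 1" "s < d" using d(1) by (auto simp: s_def)
  have in_disc: "norm (w t) < 1" if "t \<in> {0..s}" for t
    using d(2)[of t] that s w0 by (cases "t = 0") auto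
  show ?thesis
  proof (rule continuation_exists[OF path, where a = s and good = good])
    show "hyp2F1 a b c analytic_on {w t}" if "t \<in> {0..s}" for t
      using good_analytic[OF good_ball[OF in_disc[OF that]]] .
    show "good (hyp2F1 a b c) (w s)"
      using s by (intro good_ball in_disc) auto
    fix t assume "t \<in> {s..1}"
    then have "w t \<noteq> 0" "w t \<noteq> 1" using avoid[of t] s by auto
    from gauss_solution_local_extension[OF this, of a b c]
    obtain R where R: "R > 0" "\<And>q g. q \<in> ball (w t) R \<Longrightarrow> good g q \<Longrightarrow>
        \<exists>h. gauss_solution a b c h (ball (w t) R) \<and> (\<forall>\<^sub>F x in nhds q. h x = g x)"
      unfolding good_def by blast
    show "\<exists>R>0. \<forall>q\<in>ball (w t) R. \<forall>g. good g q \<longrightarrow>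
        (\<exists>h. (\<forall>q'\<in>ball (w t) R. good h q') \<and> (\<forall>\<^sub>F x in nhds q. h x = g x))"
    proof (intro exI[of _ R] conjI ballI allI impI R)
      fix q g assume "q \<in> ball (w t) R" "good g q"
      from R(2)[OF this] obtain h where "gauss_solution a b c h (ball (w t) R)" "\<forall>\<^sub>F x in nhds q. h x = g x"
        by blast
      then show "\<exists>h. (\<forall>q'\<in>ball (w t) R. good h q') \<and> (\<forall>\<^sub>F x in nhds q. h x = g x)"
        unfolding good_def by (intro exI[of _ h]) (auto intro!: exI[of _ "ball (w t) R"])
    qed
  qed (use s good_analytic in auto)
qed

lemma analytic1_at_compose:
  assumes "analytic1_at \<phi> (h x)" "h analytic_on {x}"
  shows "analytic1_at (\<lambda>x. \<phi> (h x)) x"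
  using analytic_on_compose[of h "{x}" \<phi>] assms by (simp add: analytic1_at_def o_def)

lemma continuation_compose_analytic:
  assumes "continuation_along analytic1_at \<delta> f \<Phi>" "path \<gamma>" "\<And>t. \<delta> t = h (\<gamma> t)" "h analytic_on UNIV"
  shows "continuation_along analytic1_at \<gamma> (\<lambda>x. f (h x)) (\<lambda>t x. \<Phi> t (h x))"
proof (rule continuation_compose[OF assms(1,2,3)])
  have an: "h analytic_on {x}" for x using assms(4) by (rule analytic_on_subset) auto
  show "isCont h (\<gamma> t)" for t using an[of "\<gamma> t"] by (rule analytic_at_imp_isCont)
  show "analytic1_at (\<lambda>x. \<phi> (h x)) (\<gamma> t)" if "analytic1_at \<phi> (\<delta> t)" for t \<phi>
    using analytic1_at_compose[OF _ an] that assms(3) by metis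
qed

lemma powr_linear_continuation_exists:
  fixes k p :: complex
  assumes path: "path \<gamma>" and "norm (k * \<gamma> 0) < 1" "\<And>t. t \<in> {0<..1} \<Longrightarrow> k * \<gamma> t \<noteq> 0 \<and> k * \<gamma> t \<noteq> 1"
  shows "\<exists>P. continuation_along analytic1_at \<gamma> (\<lambda>x. (1 - k * x) powr p) P"
proof -
  have "path (\<lambda>t. k * \<gamma> t)"
    using path unfolding path_def by (intro continuous_intros)
  then obtain H where "continuation_along analytic1_at (\<lambda>t. k * \<gamma> t) (hyp2F1 (- p) 1 1) H"
    using hyp2F1_continuation_exists[of 1 "\<lambda>t. k * \<gamma> t" "- p" 1] assms by auto
  then have "continuation_along analytic1_at \<gamma> (\<lambda>x. hyp2F1 (- p) 1 1 (k * x)) (\<lambda>t x. H t (k * x))"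
    using path by (rule continuation_compose_analytic) (auto intro: analytic_intros)
  moreover have "\<forall>\<^sub>F x in nhds (\<gamma> 0). hyp2F1 (- p) 1 1 (k * x) = (1 - k * x) powr p"
  proof -
    have "\<forall>\<^sub>F x in nhds (\<gamma> 0). x \<in> {x. norm (k * x) < 1}"
      using assms by (intro eventually_nhds_in_open open_Collect_less continuous_intros) auto
    then show ?thesis by eventually_elim (simp add: powr_eq_hyp2F1)
  qed
  ultimately show ?thesis by (intro exI) (rule continuation_cong)
qed

section \<open>Restriction to the curve and the theorem\<close>

text \<open>
  The chain rule: complex linearity of the Frechet derivative makes the restriction to the curve complex
  differentiable. The curve is parametrised holomorphically away from \<open>x = 1/2\<close>.
\<close>

lemma analytic2_at_curve:
  assumes "analytic2_at \<phi> (x0, x0 / (2 * x0 - 1))" and x0: "x0 \<noteq> 1/2"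
  shows "analytic1_at (\<lambda>x. \<phi> (x, x / (2 * x - 1))) x0"
proof -
  obtain U where U: "open U" "(x0, x0 / (2 * x0 - 1)) \<in> U"
    and D: "\<And>q. q \<in> U \<Longrightarrow> \<exists>a b. (\<phi> has_derivative (\<lambda>(h, k). a * h + b * k)) (at q)"
    using assms(1) unfolding analytic2_at_def by blast
  define k where "k = (\<lambda>x::complex. (x, x / (2 * x - 1)))"
  have ne: "2 * x - 1 \<noteq> 0" if "x \<noteq> 1/2" for x :: complex
    using that by (auto simp: field_simps)
  have "continuous_on (- {1/2}) k"
    unfolding k_def using ne by (intro continuous_intros) auto
  then have V: "open (k -` U \<inter> - {1/2})"
    using U(1) by (subst Int_commute, intro continuous_open_preimage) auto
  have "(\<lambda>x. \<phi> (k x)) holomorphic_on (k -` U \<inter> - {1/2})"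
  proof (rule holomorphic_onI, rule field_differentiable_at_within)
    fix x assume x: "x \<in> k -` U \<inter> - {1/2}"
    obtain a b where ab: "(\<phi> has_derivative (\<lambda>(h, k). a * h + b * k)) (at (k x))"
      using D x by blast
    define e where "e = - 1 / (2 * x - 1)\<^sup>2"
    have "((\<lambda>x. x / (2 * x - 1)) has_field_derivative e) (at x)"
      using ne[of x] x by (auto intro!: derivative_eq_intros simp: e_def power2_eq_square)
    then have "(k has_derivative (\<lambda>h. (h, e * h))) (at x)"
      unfolding k_def has_field_derivative_def by (intro has_derivative_Pair has_derivative_ident)
    from has_derivative_compose[OF this ab]
    have "((\<lambda>x. \<phi> (k x)) has_derivative (\<lambda>h. a * h + b * (e * h))) (at x)" by simp
    also have "(\<lambda>h. a * h + b * (e * h)) = (*) (a + b * e)" by (auto simp: algebra_simps)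
    finally show "(\<lambda>x. \<phi> (k x)) field_differentiable at x"
      unfolding field_differentiable_def has_field_derivative_def by blast
  qed
  then show ?thesis
    unfolding analytic1_at_def analytic_at using V U(2) x0 by (auto simp: k_def)
qed

lemma continuation_restrict_curve:
  assumes "continuation_along analytic2_at (\<lambda>t. (\<gamma> t, \<gamma> t / (2 * \<gamma> t - 1))) f \<Psi>"
    and "path \<gamma>" and "\<And>t. t \<in> {0..1} \<Longrightarrow> \<gamma> t \<noteq> 1/2"
  shows "continuation_along analytic1_at \<gamma> (\<lambda>x. f (x, x / (2 * x - 1))) (\<lambda>t x. \<Psi> t (x, x / (2 * x - 1)))"
proof (rule continuation_compose[OF assms(1,2), where h = "\<lambda>x. (x, x / (2 * x - 1))"])
  fix t :: real assume "t \<in> {0..1}"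
  then have "\<gamma> t \<noteq> 1/2" by (rule assms(3))
  then have "2 * \<gamma> t - 1 \<noteq> 0" by (auto simp: field_simps)
  then show "isCont (\<lambda>x. (x, x / (2 * x - 1))) (\<gamma> t)" by (intro continuous_intros)
  show "analytic1_at (\<lambda>x. \<phi> (x, x / (2 * x - 1))) (\<gamma> t)"
    if "analytic2_at \<phi> (\<gamma> t, \<gamma> t / (2 * \<gamma> t - 1))" for \<phi>
    using that \<open>\<gamma> t \<noteq> 1/2\<close> by (rule analytic2_at_curve)
qed simp

theorem theorem7p3:
  fixes \<alpha> \<beta> Z c b1 b2 :: complex
  assumes c_def: "c = 1 - Z"
    and b1_def: "b1 = 1/2 + \<alpha>"
    and b2_def: "b2 = 1/2 + \<beta>"
    and generic: "c \<notin> \<int>\<^sub>\<le>\<^sub>0"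
  shows "\<exists>r>0.
    (\<forall>x\<in>ball 0 r.
       appell_F3_term \<alpha> \<beta> Z x (x / (2 * x - 1)) summable_on UNIV \<and>
       norm (4 * x * (1 - x)) < 1 \<and>
       appell_F3 \<alpha> \<beta> Z x (x / (2 * x - 1)) =
         (1 - x) powr (c - 1) * (1 - 2 * x) powr b2 *
         hyp2F1 ((b2 - b1 + c) / 2) ((b1 + b2 + c - 1) / 2) c (4 * x * (1 - x))) \<and>
    (\<forall>\<gamma>. path \<gamma> \<and> \<gamma> 0 \<in> ball 0 r \<and> (\<forall>t\<in>{0<..1}. \<gamma> t \<notin> {0, 1/2, 1}) \<longrightarrow>
       (\<exists>\<Phi>. continuation_along analytic1_at \<gamma>
               (\<lambda>x. appell_F3 \<alpha> \<beta> Z x (x / (2 * x - 1))) \<Phi>) \<and>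
       (\<exists>P. continuation_along analytic1_at \<gamma> (\<lambda>x. (1 - x) powr (c - 1)) P) \<and>
       (\<exists>Q. continuation_along analytic1_at \<gamma> (\<lambda>x. (1 - 2 * x) powr b2) Q) \<and>
       (\<exists>H. continuation_along analytic1_at (\<lambda>t. 4 * \<gamma> t * (1 - \<gamma> t))
               (hyp2F1 ((b2 - b1 + c) / 2) ((b1 + b2 + c - 1) / 2) c) H) \<and>
       (\<forall>P Q H.
          continuation_along analytic1_at \<gamma> (\<lambda>x. (1 - x) powr (c - 1)) P \<and>
          continuation_along analytic1_at \<gamma> (\<lambda>x. (1 - 2 * x) powr b2) Q \<and>
          continuation_along analytic1_at (\<lambda>t. 4 * \<gamma> t * (1 - \<gamma> t))
            (hyp2F1 ((b2 - b1 + c) / 2) ((b1 + b2 + c - 1) / 2) c) H \<longrightarrow>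
          (\<forall>\<Phi>. continuation_along analytic1_at \<gamma>
                  (\<lambda>x. appell_F3 \<alpha> \<beta> Z x (x / (2 * x - 1))) \<Phi> \<longrightarrow>
             (\<forall>t\<in>{0..1}. \<forall>\<^sub>F x in nhds (\<gamma> t).
                \<Phi> t x = P t x * Q t x * H t (4 * x * (1 - x)))) \<and>
          (\<forall>\<Psi>. continuation_along analytic2_at (\<lambda>t. (\<gamma> t, \<gamma> t / (2 * \<gamma> t - 1)))
                  (\<lambda>(x, y). appell_F3 \<alpha> \<beta> Z x y) \<Psi> \<longrightarrow>
             (\<forall>t\<in>{0..1}. \<forall>\<^sub>F x in nhds (\<gamma> t).
                \<Psi> t (x, x / (2 * x - 1)) = P t x * Q t x * H t (4 * x * (1 - x))))))"
proof -
  define A where "A = (b2 - b1 + c) / 2"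
  define B where "B = (b1 + b2 + c - 1) / 2"
  let ?F = "\<lambda>x. appell_F3 \<alpha> \<beta> Z x (x / (2 * x - 1))"
  obtain r where r: "0 < r" "r \<le> 1/10"
    and summable: "\<And>x. norm x < r \<Longrightarrow> appell_F3_term \<alpha> \<beta> Z x (x / (2 * x - 1)) summable_on UNIV"
    and identity: "\<And>x. norm x < r \<Longrightarrow> ?F x =
         (1 - x) powr (c - 1) * (1 - 2 * x) powr b2 * hyp2F1 A B c (4 * x * (1 - x))"
    using appell_F3_reduction[OF assms] unfolding A_def B_def by metis
  have w_small: "norm (4 * x * (1 - x)) < 1" if "norm x < r" for x :: complex
  proof -
    have "norm (4 * x * (1 - x)) \<le> 4 * norm x * (1 + norm x)"
      using norm_triangle_ineq4[of 1 x] by (auto simp: norm_mult intro: mult_left_mono)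
    also have "\<dots> \<le> 4 * (1/10) * (1 + 1/10)"
      using that r by (intro mult_mono) auto
    finally show ?thesis by simp
  qed
  \<comment> \<open>The paths of the theorem, named to state the existence results once.\<close>
  define admissible where "admissible \<gamma> \<longleftrightarrow> path \<gamma> \<and> \<gamma> 0 \<in> ball 0 r \<and> (\<forall>t\<in>{0<..1}. \<gamma> t \<notin> {0, 1/2, 1})"
    for \<gamma> :: "real \<Rightarrow> complex"
  have P_exists: "\<exists>P. continuation_along analytic1_at \<gamma> (\<lambda>x. (1 - x) powr (c - 1)) P"
    if "admissible \<gamma>" for \<gamma>
    using powr_linear_continuation_exists[of \<gamma> 1 "c - 1"] that r by (auto simp: admissible_def)
  have Q_exists: "\<exists>Q. continuation_along analytic1_at \<gamma> (\<lambda>x. (1 - 2 * x) powr b2) Q"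
    if "admissible \<gamma>" for \<gamma>
  proof (rule powr_linear_continuation_exists)
    show "2 * \<gamma> t \<noteq> 0 \<and> 2 * \<gamma> t \<noteq> 1" if "t \<in> {0<..1}" for t
      using that \<open>admissible \<gamma>\<close> by (auto simp: admissible_def field_simps)
  qed (use that r in \<open>auto simp: admissible_def norm_mult\<close>)
  have H_exists: "\<exists>H. continuation_along analytic1_at (\<lambda>t. 4 * \<gamma> t * (1 - \<gamma> t)) (hyp2F1 A B c) H"
    if "admissible \<gamma>" for \<gamma>
  proof (rule hyp2F1_continuation_exists[OF generic])
    show "path (\<lambda>t. 4 * \<gamma> t * (1 - \<gamma> t))"
      using that unfolding admissible_def path_def by (intro continuous_intros) auto
    show "norm (4 * \<gamma> 0 * (1 - \<gamma> 0)) < 1"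
      using that by (intro w_small) (simp add: admissible_def)
    show "4 * \<gamma> t * (1 - \<gamma> t) \<noteq> 0 \<and> 4 * \<gamma> t * (1 - \<gamma> t) \<noteq> 1" if "t \<in> {0<..1}" for t
    proof -
      have "\<gamma> t \<noteq> 0" "\<gamma> t \<noteq> 1/2" "\<gamma> t \<noteq> 1"
        using \<open>admissible \<gamma>\<close> that by (auto simp: admissible_def)
      \<comment> \<open>The map \<open>x \<mapsto> 4 * x * (1 - x)\<close> ramifies at \<open>1/2\<close>, the only point over 1.\<close>
      moreover have "1 - 4 * \<gamma> t * (1 - \<gamma> t) = (1 - 2 * \<gamma> t)\<^sup>2"
        by (simp add: power2_eq_square algebra_simps)
      ultimately show ?thesis by (auto simp: field_simps)
    qed
  qed
  have product: "continuation_along analytic1_at \<gamma> ?F (\<lambda>t x. P t x * Q t x * H t (4 * x * (1 - x)))"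
    if \<gamma>: "admissible \<gamma>" and P: "continuation_along analytic1_at \<gamma> (\<lambda>x. (1 - x) powr (c - 1)) P"
      and Q: "continuation_along analytic1_at \<gamma> (\<lambda>x. (1 - 2 * x) powr b2) Q"
      and H: "continuation_along analytic1_at (\<lambda>t. 4 * \<gamma> t * (1 - \<gamma> t)) (hyp2F1 A B c) H" for \<gamma> P Q H
  proof (rule continuation_cong)
    have "continuation_along analytic1_at \<gamma> (\<lambda>x. hyp2F1 A B c (4 * x * (1 - x))) (\<lambda>t x. H t (4 * x * (1 - x)))"
      using \<gamma> by (intro continuation_compose_analytic[OF H]) (auto simp: admissible_def intro!: analytic_intros)
    then show "continuation_along analytic1_at \<gamma>
        (\<lambda>x. (1 - x) powr (c - 1) * (1 - 2 * x) powr b2 * hyp2F1 A B c (4 * x * (1 - x)))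
        (\<lambda>t x. P t x * Q t x * H t (4 * x * (1 - x)))"
      by (intro continuation_mult P Q)
    have "\<forall>\<^sub>F x in nhds (\<gamma> 0). x \<in> ball 0 r"
      using \<gamma> by (intro eventually_nhds_in_open) (auto simp: admissible_def)
    then show "\<forall>\<^sub>F x in nhds (\<gamma> 0). (1 - x) powr (c - 1) * (1 - 2 * x) powr b2 * hyp2F1 A B c (4 * x * (1 - x)) = ?F x"
      by eventually_elim (simp add: identity)
  qed
  show ?thesis
    unfolding A_def[symmetric] B_def[symmetric]
  proof (rule exI[of _ r], unfold admissible_def[symmetric], intro conjI ballI allI impI; (elim conjE)?)
    show "r > 0" by fact
    show "appell_F3_term \<alpha> \<beta> Z x (x / (2 * x - 1)) summable_on UNIV" "norm (4 * x * (1 - x)) < 1"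
      "?F x = (1 - x) powr (c - 1) * (1 - 2 * x) powr b2 * hyp2F1 A B c (4 * x * (1 - x))"
      if "x \<in> ball 0 r" for x
      using that by (auto intro: summable w_small identity)
  next
    fix \<gamma> assume \<gamma>: "admissible \<gamma>"
    show "\<exists>P. continuation_along analytic1_at \<gamma> (\<lambda>x. (1 - x) powr (c - 1)) P"
      by (rule P_exists[OF \<gamma>])
    show "\<exists>Q. continuation_along analytic1_at \<gamma> (\<lambda>x. (1 - 2 * x) powr b2) Q"
      by (rule Q_exists[OF \<gamma>])
    show "\<exists>H. continuation_along analytic1_at (\<lambda>t. 4 * \<gamma> t * (1 - \<gamma> t)) (hyp2F1 A B c) H"
      by (rule H_exists[OF \<gamma>])
    show "\<exists>\<Phi>. continuation_along analytic1_at \<gamma> ?F \<Phi>"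
      using product[OF \<gamma>] P_exists[OF \<gamma>] Q_exists[OF \<gamma>] H_exists[OF \<gamma>] by blast
  next
    fix \<gamma> P Q H \<Phi> and t :: real
    assume \<gamma>: "admissible \<gamma>" and t: "t \<in> {0..1}"
      and PQH: "continuation_along analytic1_at \<gamma> (\<lambda>x. (1 - x) powr (c - 1)) P"
        "continuation_along analytic1_at \<gamma> (\<lambda>x. (1 - 2 * x) powr b2) Q"
        "continuation_along analytic1_at (\<lambda>t. 4 * \<gamma> t * (1 - \<gamma> t)) (hyp2F1 A B c) H"
      and \<Phi>: "continuation_along analytic1_at \<gamma> ?F \<Phi>"
    show "\<forall>\<^sub>F x in nhds (\<gamma> t). \<Phi> t x = P t x * Q t x * H t (4 * x * (1 - x))"
      by (rule continuation_unique[OF \<Phi> product[OF \<gamma> PQH] _ t]) simp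
  next
    fix \<gamma> P Q H \<Psi> and t :: real
    assume \<gamma>: "admissible \<gamma>" and t: "t \<in> {0..1}"
      and PQH: "continuation_along analytic1_at \<gamma> (\<lambda>x. (1 - x) powr (c - 1)) P"
        "continuation_along analytic1_at \<gamma> (\<lambda>x. (1 - 2 * x) powr b2) Q"
        "continuation_along analytic1_at (\<lambda>t. 4 * \<gamma> t * (1 - \<gamma> t)) (hyp2F1 A B c) H"
      and \<Psi>: "continuation_along analytic2_at (\<lambda>t. (\<gamma> t, \<gamma> t / (2 * \<gamma> t - 1))) (\<lambda>(x, y). appell_F3 \<alpha> \<beta> Z x y) \<Psi>"
    have "\<gamma> 0 \<noteq> 1/2"
    proof
      assume "\<gamma> 0 = 1/2"
      then have "norm (\<gamma> 0) = 1/2" by (simp only:) (simp add: norm_divide)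
      with \<gamma> r show False by (simp add: admissible_def)
    qed
    then have "\<gamma> s \<noteq> 1/2" if "s \<in> {0..1}" for s
      using \<gamma> that by (cases "s = 0") (auto simp: admissible_def)
    then have "continuation_along analytic1_at \<gamma> ?F (\<lambda>t x. \<Psi> t (x, x / (2 * x - 1)))"
      using continuation_restrict_curve[OF \<Psi>] \<gamma> by (simp add: admissible_def)
    from continuation_unique[OF this product[OF \<gamma> PQH] _ t]
    show "\<forall>\<^sub>F x in nhds (\<gamma> t). \<Psi> t (x, x / (2 * x - 1)) = P t x * Q t x * H t (4 * x * (1 - x))"
      by simp
  qed
qed

end
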